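(* Let $\rho_r=(r-1)!\sqrt[r]{4}$. For $r\geq 5$, every $r$-uniform hypergraph $H$ with $\rho(H)\leq\rho_r$ is reducible. For $r=4$, a connected irreducible $4$-uniform hypergraph $H$ satisfies $\rho(H)\leq\rho_4$ if and only if $H$ is isomorphic to one of $H^{(4)}_{1,1,2,2}$, $H^{(4)}_{1,1,1,1}$, $H^{(4)}_{1,1,1,2}$, $H^{(4)}_{1,1,1,3}$, $H^{(4)}_{1,1,1,4}$.
   Context: An $r$-uniform hypergraph $H=(V,E)$ has a finite vertex set $V$ and edge set $E\subseteq\binom{V}{r}$. A leaf vertex is a vertex contained in exactly one edge. A walk is a sequence $v_0e_1v_1\cdots e_lv_l$ with $v_{i-1},v_i\in e_i$; $H$ is connected if any two vertices are joined by a walk. The spectral radius is $\rho(H)=\max_{x\in\mathbb{R}^{V}_{\geq 0},x\neq 0} \frac{r!\sum_{e\in E}\prod_{v\in e}x_v}{\sum_{v\in V}x_v^r}$. $H$ is called reducible if every edge of $H$ contains at least one leaf vertex, and irreducible otherwise. A $4$-uniform path of length $k\geq 1$ is a sequence of $4$-element edges $e_1,\dots,e_k$ with $|e_i\cap e_{i+1}|=1$ and $e_i\cap e_j=\emptyset$ for $|i-j|\geq2$; attaching a pendant path of length $k$ at a vertex $v$ means adding such a path with $v\in e_1$, $v\notin e_j$ for $j\geq 2$, all other vertices new. $H^{(4)}_{i,j,k,l}$ ($i,j,k,l\geq1$) is the $4$-uniform hypergraph consisting of an edge $F_0=\{a,b,c,d\}$ with pendant paths of lengths $i,j,k,l$ attached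 at $a,b,c,d$ respectively. *)

theory Defs
  imports "HOL-Analysis.Analysis"
begin

record 'a hypergraph =
  verts :: "'a set"
  edges :: "'a set set"

definition uniform_hypergraph :: "nat \<Rightarrow> 'a hypergraph \<Rightarrow> bool" where
  "uniform_hypergraph r H \<longleftrightarrow>
     finite (verts H) \<and> (\<forall>e\<in>edges H. e \<subseteq> verts H \<and> card e = r)"

definition leaf_vertex :: "'a hypergraph \<Rightarrow> 'a \<Rightarrow> bool" where
  "leaf_vertex H v \<longleftrightarrow> v \<in> verts H \<and> (\<exists>!e. e \<in> edges H \<and> v \<in> e)"

definition reducible :: "'a hypergraph \<Rightarrow> bool" where
  "reducible H \<longleftrightarrow> (\<forall>e\<in>edges H. \<exists>v\<in>e. leaf_vertex H v)"

definition walk :: "'a hypergraph \<Rightarrow> 'a list \<Rightarrow> 'a set list \<Rightarrow> bool" where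
  "walk H vs es \<longleftrightarrow>
     length vs = Suc (length es) \<and> set vs \<subseteq> verts H \<and> set es \<subseteq> edges H \<and>
     (\<forall>i<length es. vs ! i \<in> es ! i \<and> vs ! Suc i \<in> es ! i)"

definition connected_hypergraph :: "'a hypergraph \<Rightarrow> bool" where
  "connected_hypergraph H \<longleftrightarrow>
     (\<forall>u\<in>verts H. \<forall>w\<in>verts H. \<exists>vs es. walk H vs es \<and> hd vs = u \<and> last vs = w)"

definition hypergraph_iso :: "'a hypergraph \<Rightarrow> 'b hypergraph \<Rightarrow> bool" where
  "hypergraph_iso H K \<longleftrightarrow>
     (\<exists>f. bij_betw f (verts H) (verts K) \<and> (image f) ` edges H = edges K)"

text \<open>A vector indexed by the vertices is any function on the vertex type; only its values on
  the vertex set matter.\<close>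

definition rayleigh_quotient :: "nat \<Rightarrow> 'a hypergraph \<Rightarrow> ('a \<Rightarrow> real) \<Rightarrow> real" where
  "rayleigh_quotient r H x =
     fact r * (\<Sum>e\<in>edges H. \<Prod>v\<in>e. x v) / (\<Sum>v\<in>verts H. x v ^ r)"

definition nonneg_vector :: "'a hypergraph \<Rightarrow> ('a \<Rightarrow> real) \<Rightarrow> bool" where
  "nonneg_vector H x \<longleftrightarrow> (\<forall>v\<in>verts H. 0 \<le> x v) \<and> (\<exists>v\<in>verts H. x v \<noteq> 0)"

text \<open>The supremum is a maximum, see \<open>spectral_radius_is_max\<close> below. The quotients exist only
  if there is a vertex; for an empty vertex set the value is unspecified.\<close>

definition spectral_radius :: "nat \<Rightarrow> 'a hypergraph \<Rightarrow> real" where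
  "spectral_radius r H = (SUP x\<in>{x. nonneg_vector H x}. rayleigh_quotient r H x)"

definition rho_bound :: "nat \<Rightarrow> real" where
  "rho_bound r = fact (r - 1) * root r 4"

lemma spectral_radius_is_max:
  assumes H: "uniform_hypergraph r H" and r: "1 \<le> r" and ne: "verts H \<noteq> {}"
  shows "\<exists>x. nonneg_vector H x \<and> rayleigh_quotient r H x = spectral_radius r H"
    and "nonneg_vector H x \<Longrightarrow> rayleigh_quotient r H x \<le> spectral_radius r H"
proof -
  let ?V = "verts H" and ?E = "edges H"
  have fin: "finite ?V" and sub: "\<And>e. e \<in> ?E \<Longrightarrow> e \<subseteq> ?V" and card: "\<And>e. e \<in> ?E \<Longrightarrow> card e = r"
    using H by (auto simp: uniform_hypergraph_def)
  define B :: "'a \<Rightarrow> real set" where "B = (\<lambda>v. if v \<in> ?V then {0..1} else {0})"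
  define S where "S = (\<lambda>x::'a \<Rightarrow> real. \<Sum>v\<in>?V. x v ^ r)"
  define N where "N = (\<lambda>x::'a \<Rightarrow> real. \<Sum>e\<in>?E. \<Prod>v\<in>e. x v)"
  define K where "K = {x. (\<forall>v. x v \<in> B v) \<and> S x = 1}"
  have quot: "rayleigh_quotient r H x = fact r * N x / S x" for x
    by (simp add: rayleigh_quotient_def N_def S_def)
  have contS: "continuous_on A S" and contN: "continuous_on A N" for A
    unfolding S_def N_def
    by (intro continuous_intros continuous_on_subset[OF continuous_on_product_coordinates]; simp)+
  have "compactin (product_topology (\<lambda>_. euclidean) UNIV) (PiE UNIV B)"
    by (simp add: compactin_PiE B_def)
  then have cB: "compact (PiE UNIV B)"
    by (simp add: euclidean_product_topology)
  have "closed {x. S x = 1}"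
    by (intro closed_Collect_eq contS continuous_intros)
  then have "compact (PiE UNIV B \<inter> {x. S x = 1})"
    by (rule compact_Int_closed[OF cB])
  also have "PiE UNIV B \<inter> {x. S x = 1} = K"
    by (auto simp: K_def)
  finally have cK: "compact K" .
  have normalize: "\<exists>y\<in>K. nonneg_vector H y \<and> rayleigh_quotient r H x = rayleigh_quotient r H y"
    if x: "nonneg_vector H x" for x
  proof -
    from x obtain w where w: "w \<in> ?V" "x w \<noteq> 0" and nn: "\<And>v. v \<in> ?V \<Longrightarrow> 0 \<le> x v"
      by (auto simp: nonneg_vector_def)
    have "0 < x w ^ r" using w nn[of w] by simp
    also have "x w ^ r \<le> S x"
      unfolding S_def using fin w nn by (intro member_le_sum) auto
    finally have Spos: "0 < S x" .
    define c where "c = root r (S x)"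
    have c: "0 < c" "c ^ r = S x"
      using Spos r by (auto simp: c_def)
    define y where "y = (\<lambda>v. if v \<in> ?V then x v / c else 0)"
    have "S y = (\<Sum>v\<in>?V. x v ^ r / c ^ r)"
      unfolding S_def by (rule sum.cong) (auto simp: y_def power_divide)
    also have "\<dots> = S x / c ^ r" by (simp add: S_def sum_divide_distrib)
    finally have Sy: "S y = 1" using c Spos by simp
    have "N y = (\<Sum>e\<in>?E. (\<Prod>v\<in>e. x v) / c ^ r)"
      unfolding N_def
    proof (rule sum.cong[OF refl])
      fix e assume e: "e \<in> ?E"
      have "(\<Prod>v\<in>e. y v) = (\<Prod>v\<in>e. x v / c)"
        using sub[OF e] by (intro prod.cong) (auto simp: y_def)
      then show "(\<Prod>v\<in>e. y v) = (\<Prod>v\<in>e. x v) / c ^ r"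
        using card[OF e] by (simp add: prod_dividef)
    qed
    also have "\<dots> = N x / S x" by (simp add: N_def sum_divide_distrib c)
    finally have eq: "rayleigh_quotient r H x = rayleigh_quotient r H y"
      by (simp add: quot Sy)
    have y0: "0 \<le> y v" for v using nn c by (simp add: y_def)
    have "y v \<in> B v" for v
    proof (cases "v \<in> ?V")
      case True
      have "y v ^ r \<le> S y"
        unfolding S_def using fin True y0 by (intro member_le_sum) auto
      then have "y v ^ r \<le> 1 ^ r" by (simp add: Sy)
      then have "y v \<le> 1" using y0 r by (subst (asm) power_mono_iff) auto
      then show ?thesis using True y0 by (simp add: B_def)
    qed (simp add: B_def y_def)
    moreover have "nonneg_vector H y"
      using w y0 c by (auto simp: nonneg_vector_def) (auto simp: y_def intro!: bexI[of _ w])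
    ultimately show ?thesis using Sy eq by (auto simp: K_def)
  qed
  have KN: "nonneg_vector H y" if "y \<in> K" for y
  proof -
    have "0 \<le> y v" for v
      using that by (auto simp: K_def B_def dest!: spec[of _ v] split: if_splits)
    moreover have "\<exists>v\<in>?V. y v \<noteq> 0"
    proof (rule ccontr)
      assume "\<not> ?thesis"
      then have "S y = 0" using r by (simp add: S_def power_0_left)
      then show False using that by (simp add: K_def)
    qed
    ultimately show ?thesis by (simp add: nonneg_vector_def)
  qed
  have "nonneg_vector H (\<lambda>_. 1)" using ne by (auto simp: nonneg_vector_def)
  then have "K \<noteq> {}" using normalize by blast
  moreover have "continuous_on K (\<lambda>x. fact r * N x)"
    by (intro continuous_intros contN)
  ultimately obtain z where z: "z \<in> K" "\<And>y. y \<in> K \<Longrightarrow> fact r * N y \<le> fact r * N z"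
    using continuous_attains_sup[OF cK] by blast
  have ub: "rayleigh_quotient r H x \<le> rayleigh_quotient r H z" if x: "nonneg_vector H x" for x
  proof -
    obtain y where "y \<in> K" "rayleigh_quotient r H x = rayleigh_quotient r H y"
      using normalize[OF x] by blast
    then show ?thesis using z(2)[of y] z(1) by (simp add: quot K_def)
  qed
  have "spectral_radius r H = rayleigh_quotient r H z"
    unfolding spectral_radius_def
    by (rule cSup_eq_maximum) (use KN[OF z(1)] ub in auto)
  then show "\<exists>x. nonneg_vector H x \<and> rayleigh_quotient r H x = spectral_radius r H"
    and "nonneg_vector H x \<Longrightarrow> rayleigh_quotient r H x \<le> spectral_radius r H"
    using KN[OF z(1)] ub by auto
qed

definition uniform_path :: "nat \<Rightarrow> 'a set list \<Rightarrow> bool" where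
  "uniform_path r es \<longleftrightarrow>
     1 \<le> length es \<and> (\<forall>e\<in>set es. card e = r) \<and>
     (\<forall>i. Suc i < length es \<longrightarrow> card (es ! i \<inter> es ! Suc i) = 1) \<and>
     (\<forall>i j. i + 2 \<le> j \<and> j < length es \<longrightarrow> es ! i \<inter> es ! j = {})"

definition pendant_path :: "nat \<Rightarrow> 'a \<Rightarrow> 'a set list \<Rightarrow> bool" where
  "pendant_path r v es \<longleftrightarrow>
     uniform_path r es \<and> v \<in> es ! 0 \<and> (\<forall>j. 1 \<le> j \<and> j < length es \<longrightarrow> v \<notin> es ! j)"

text \<open>A concrete copy of $H^{(4)}_{i,j,k,l}$ on pairs (branch, position): the central edge
  consists of the position-0 vertices of the branches 0, 1, 2, 3, and the \<open>t\<close>-th edge of a branch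
  occupies the positions \<open>3 * t, \<dots>, 3 * t + 3\<close>, so that consecutive edges share one vertex.
  Lemma \<open>H4_pendant_paths\<close> confirms that the branches are pendant paths of the prescribed
  lengths attached at the four vertices of the central edge.\<close>

definition H4_edge :: "nat \<Rightarrow> nat \<Rightarrow> (nat \<times> nat) set" where
  "H4_edge p t = {p} \<times> {3 * t..3 * t + 3}"

definition H4_centre :: "(nat \<times> nat) set" where
  "H4_centre = {(0, 0), (1, 0), (2, 0), (3, 0)}"

definition H4_branch :: "nat list \<Rightarrow> nat \<Rightarrow> (nat \<times> nat) set list" where
  "H4_branch ls p = map (H4_edge p) [0..<ls ! p]"

definition H4 :: "nat \<Rightarrow> nat \<Rightarrow> nat \<Rightarrow> nat \<Rightarrow> (nat \<times> nat) hypergraph" where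
  "H4 i j k l =
     \<lparr>verts = (\<Union>p<4. {p} \<times> {0..3 * [i, j, k, l] ! p}),
      edges = insert H4_centre (\<Union>p<4. set (H4_branch [i, j, k, l] p))\<rparr>"

lemma H4_pendant_paths:
  fixes i j k l :: nat
  assumes pos: "1 \<le> i" "1 \<le> j" "1 \<le> k" "1 \<le> l"
  defines "ls \<equiv> [i, j, k, l]"
  shows "uniform_hypergraph 4 (H4 i j k l)"
    and "verts (H4 i j k l) = \<Union> (edges (H4 i j k l))"
    and "p < 4 \<Longrightarrow> length (H4_branch ls p) = ls ! p"
    and "p < 4 \<Longrightarrow> pendant_path 4 (p, 0) (H4_branch ls p)"
    and "p < 4 \<Longrightarrow> \<Union> (set (H4_branch ls p)) \<inter> H4_centre = {(p, 0)}"
    and "p < 4 \<Longrightarrow> q < 4 \<Longrightarrow> p \<noteq> q \<Longrightarrow>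
           \<Union> (set (H4_branch ls p)) \<inter> \<Union> (set (H4_branch ls q)) = {}"
proof -
  have four: "p < 4 \<longleftrightarrow> p = 0 \<or> p = 1 \<or> p = 2 \<or> p = 3" for p :: nat by auto
  have lpos: "1 \<le> ls ! p" if "p < 4" for p
    using that pos by (auto simp: four ls_def)
  have card: "card (H4_edge p t) = 4" for p t
    by (simp add: H4_edge_def card_cartesian_product)
  have cover: "\<Union> (set (H4_branch ls p)) = {p} \<times> {0..3 * ls ! p}" if "p < 4" for p
  proof -
    have "\<exists>t<ls ! p. n \<in> {3 * t..3 * t + 3}" if "n \<le> 3 * ls ! p" for n
      using that lpos[OF \<open>p < 4\<close>]
      by (intro exI[of _ "if n = 3 * ls ! p then ls ! p - 1 else n div 3"]) auto
    then show ?thesis by (fastforce simp: H4_branch_def H4_edge_def)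
  qed
  show "length (H4_branch ls p) = ls ! p" by (simp add: H4_branch_def)
  have centre: "H4_centre = (\<lambda>p. (p, 0)) ` {..<4}"
    by (auto simp: H4_centre_def four)
  have ccard: "card H4_centre = 4" by (simp add: H4_centre_def)
  show verts: "verts (H4 i j k l) = \<Union> (edges (H4 i j k l))"
  proof -
    have "\<Union> (edges (H4 i j k l)) = H4_centre \<union> (\<Union>p<4. \<Union> (set (H4_branch ls p)))"
      by (auto simp: H4_def ls_def)
    also have "\<dots> = H4_centre \<union> (\<Union>p<4. {p} \<times> {0..3 * ls ! p})"
      using cover by simp
    also have "\<dots> = verts (H4 i j k l)"
      by (auto simp: H4_def centre ls_def)
    finally show ?thesis by simp
  qed
  have "finite (verts (H4 i j k l))" by (auto simp: H4_def)
  moreover have "card e = 4" if "e \<in> edges (H4 i j k l)" for e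
    using that card ccard by (auto simp: H4_def H4_branch_def)
  ultimately show "uniform_hypergraph 4 (H4 i j k l)"
    using verts by (auto simp: uniform_hypergraph_def)
  show "pendant_path 4 (p, 0) (H4_branch ls p)" if "p < 4"
  proof -
    have "H4_edge p t \<inter> H4_edge p (Suc t) = {(p, 3 * t + 3)}" for t
      by (auto simp: H4_edge_def)
    moreover have "H4_edge p s \<inter> H4_edge p t = {}" if "s + 2 \<le> t" for s t
      using that by (auto simp: H4_edge_def)
    ultimately show ?thesis
      using lpos[OF that] card
      by (auto simp: pendant_path_def uniform_path_def H4_branch_def) (auto simp: H4_edge_def)
  qed
  show "\<Union> (set (H4_branch ls p)) \<inter> H4_centre = {(p, 0)}" if "p < 4"
    using that by (auto simp: cover centre)
  show "\<Union> (set (H4_branch ls p)) \<inter> \<Union> (set (H4_branch ls q)) = {}"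
    if "p < 4" "q < 4" "p \<noteq> q"
    using that by (auto simp: cover)
qed

end

theory Submission
  imports Defs
begin

text \<open>The condition \<open>\<rho>(H) \<le> \<rho>\<^sub>r\<close> is restated through labels \<open>B v e > 0\<close> on the incidences such that
  the labels at each vertex sum to at most 1 and the labels in each edge multiply to at least
  \<open>1 / 4\<close>. For a connected hypergraph a maximizer \<open>x\<close> of the Rayleigh quotient is positive, and
  stationarity makes \<open>B v e = (r - 1)! * (\<Prod>u\<in>e. x u) / (\<rho> * x v ^ r)\<close> such a labelling;
  conversely, a labelling bounds the Rayleigh quotient by the inequality of arithmetic and geometric
  means.

  All labels are at least \<open>1 / 4\<close>, so labels at non-leaf vertices are at most \<open>3 / 4\<close>. Since
  \<open>(3 / 4) ^ 5 < 1 / 4\<close>, an edge of at least five vertices has a leaf. For \<open>r = 4\<close> an edge \<open>F\<close>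
  without leaves has all labels at least \<open>16 / 27\<close>, so each of its vertices lies in one further
  edge, where its label is at most \<open>11 / 27\<close>. Such a small label forces the edge to have at most
  one other non-leaf vertex, which again lies in one further edge with a smaller label, and so on:
  pendant paths grow out of \<open>F\<close>, and the label at \<open>F\<close> of a vertex carrying a path of length \<open>l\<close>
  is at most \<open>1 - l / (2 * (l + 1))\<close>. The product of these four bounds is at least \<open>1 / 4\<close> for the
  five listed quadruples of lengths only.\<close>

section \<open>Labellings as upper bounds for the spectral radius\<close>

text \<open>In the language of weighted incidence matrices these are the alpha-subnormal labellings
  with alpha = 1/4; the 4 under the root in \<open>rho_bound\<close> is 1 / alpha.\<close>

definition normal_labelling :: "'a hypergraph \<Rightarrow> ('a \<Rightarrow> 'a set \<Rightarrow> real) \<Rightarrow> bool" where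
  "normal_labelling H B \<longleftrightarrow>
     (\<forall>e\<in>edges H. \<forall>v\<in>e. 0 < B v e) \<and>
     (\<forall>v\<in>verts H. (\<Sum>e | e \<in> edges H \<and> v \<in> e. B v e) \<le> 1) \<and>
     (\<forall>e\<in>edges H. 1 / 4 \<le> (\<Prod>v\<in>e. B v e))"

lemma uniform_hypergraphD:
  assumes "uniform_hypergraph r H"
  shows "finite (verts H)" "finite (edges H)"
    "e \<in> edges H \<Longrightarrow> e \<subseteq> verts H" "e \<in> edges H \<Longrightarrow> card e = r" "e \<in> edges H \<Longrightarrow> finite e"
proof -
  show V: "finite (verts H)" and s: "e \<in> edges H \<Longrightarrow> e \<subseteq> verts H"
    and "e \<in> edges H \<Longrightarrow> card e = r" for e
    using assms by (auto simp: uniform_hypergraph_def)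
  show "finite (edges H)"
    by (rule finite_subset[of _ "Pow (verts H)"]) (use V s in auto)
  show "e \<in> edges H \<Longrightarrow> finite e" for e
    using V s finite_subset by blast
qed

text \<open>The arithmetic-geometric mean inequality for the numbers \<open>b v * x v ^ r\<close>:
  their geometric mean is the product of the \<open>x v\<close> times the root of the product of the
  weights, which is at least \<open>1 / root r 4\<close>.\<close>

lemma prod_le_weighted_power_sum:
  fixes x b :: "'a \<Rightarrow> real"
  assumes r: "card e = r" "1 \<le> r" and b: "\<And>v. v \<in> e \<Longrightarrow> 0 < b v" "1 / 4 \<le> (\<Prod>v\<in>e. b v)"
    and x: "\<And>v. v \<in> e \<Longrightarrow> 0 \<le> x v"
  shows "r * (\<Prod>v\<in>e. x v) \<le> root r 4 * (\<Sum>v\<in>e. b v * x v ^ r)"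
proof -
  have fin: "finite e" "e \<noteq> {}" using r card.infinite[of e] by auto
  define P where "P = (\<Prod>v\<in>e. x v)"
  have P: "0 \<le> P" unfolding P_def by (intro prod_nonneg) (use x in auto)
  let ?y = "\<lambda>v. b v * x v ^ r"
  have y: "0 \<le> ?y v" if "v \<in> e" for v using b(1)[OF that] x[OF that] by simp
  have "(\<Prod>v\<in>e. ?y v) = (\<Prod>v\<in>e. b v) * P ^ r"
    by (simp add: P_def prod.distrib prod_power_distrib)
  then have lower: "P ^ r / 4 \<le> (\<Prod>v\<in>e. ?y v)"
    using mult_right_mono[OF b(2), of "P ^ r"] P by simp
  show ?thesis
  \<comment> \<open>Rewriting \<open>root\<close> as \<open>powr\<close> requires a positive
    product, so \<open>P = 0\<close> is treated separately; there the right-hand side is merely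
    nonnegative.\<close>
  proof (cases "P = 0")
    case True
    then show ?thesis
      using y r by (simp add: P_def[symmetric] sum_nonneg)
  next
    case False
    then have Pp: "0 < P" using P by simp
    have "P / root r 4 = root r (P ^ r / 4)"
      using r P by (simp add: real_root_divide real_root_power_cancel)
    also have "\<dots> \<le> root r (\<Prod>v\<in>e. ?y v)" using lower r by simp
    also have "\<dots> = (\<Prod>v\<in>e. ?y v) powr (1 / card e)"
    proof -
      have "0 < P ^ r / 4" using Pp by simp
      then have "0 < (\<Prod>v\<in>e. ?y v)" using lower by linarith
      then show ?thesis using r by (simp add: root_powr_inverse)
    qed
    also have "\<dots> \<le> (\<Sum>v\<in>e. ?y v / card e)"
      by (rule arith_geom_mean) (use fin y in auto)
    also have "\<dots> = (\<Sum>v\<in>e. ?y v) / r" using r by (simp add: sum_divide_distrib)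
    finally show ?thesis
      using r by (simp add: P_def[symmetric] field_simps)
  qed
qed

text \<open>Summing the edge inequalities and exchanging the order of summation gives each
  \<open>x v ^ r\<close> the label sum of its vertex as coefficient, which is at most 1.\<close>

lemma spectral_radius_le_if_normal_labelling:
  assumes H: "uniform_hypergraph r H" and r: "1 \<le> r" and ne: "verts H \<noteq> {}"
    and B: "normal_labelling H B"
  shows "spectral_radius r H \<le> rho_bound r"
proof -
  note H' = uniform_hypergraphD[OF H]
  obtain x where x: "nonneg_vector H x" and xs: "rayleigh_quotient r H x = spectral_radius r H"
    using spectral_radius_is_max(1)[OF H r ne] by blast
  let ?S = "\<Sum>v\<in>verts H. x v ^ r"
  have S0: "0 \<le> ?S" using x by (intro sum_nonneg) (auto simp: nonneg_vector_def)
  have fact_r: "fact r = real r * fact (r - 1)" using r by (simp add: fact_reduce)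
  have "r * (\<Sum>e\<in>edges H. \<Prod>v\<in>e. x v)
      \<le> (\<Sum>e\<in>edges H. root r 4 * (\<Sum>v\<in>e. B v e * x v ^ r))"
  proof (subst sum_distrib_left, rule sum_mono, rule prod_le_weighted_power_sum)
  qed (use H' r B x in \<open>auto simp: normal_labelling_def nonneg_vector_def subset_eq\<close>)
  also have "\<dots> = root r 4 * (\<Sum>e\<in>edges H. \<Sum>v | v \<in> verts H \<and> v \<in> e. B v e * x v ^ r)"
  proof -
    have "e = {v \<in> verts H. v \<in> e}" if "e \<in> edges H" for e using H'(3)[OF that] by auto
    then show ?thesis by (simp add: sum_distrib_left)
  qed
  also have "(\<Sum>e\<in>edges H. \<Sum>v | v \<in> verts H \<and> v \<in> e. B v e * x v ^ r)
      = (\<Sum>v\<in>verts H. (\<Sum>e | e \<in> edges H \<and> v \<in> e. B v e) * x v ^ r)"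
    using sum.swap_restrict[OF H'(2,1), of "\<lambda>e v. B v e * x v ^ r" "\<lambda>e v. v \<in> e"]
    by (simp add: sum_distrib_right)
  also have "root r 4 * (\<Sum>v\<in>verts H. (\<Sum>e | e \<in> edges H \<and> v \<in> e. B v e) * x v ^ r)
      \<le> root r 4 * ?S"
  proof (intro mult_left_mono sum_mono)
    fix v assume "v \<in> verts H"
    then show "(\<Sum>e | e \<in> edges H \<and> v \<in> e. B v e) * x v ^ r \<le> x v ^ r"
      using B x by (intro mult_left_le_one_le sum_nonneg zero_le_power)
        (auto simp: normal_labelling_def nonneg_vector_def intro!: less_imp_le)
  qed (use r in simp)
  finally have "r * (\<Sum>e\<in>edges H. \<Prod>v\<in>e. x v) \<le> root r 4 * ?S" .
  then have "fact (r - 1) * (r * (\<Sum>e\<in>edges H. \<Prod>v\<in>e. x v)) \<le> fact (r - 1) * (root r 4 * ?S)"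
    by (intro mult_left_mono) auto
  then have le: "fact r * (\<Sum>e\<in>edges H. \<Prod>v\<in>e. x v) \<le> rho_bound r * ?S"
    by (simp add: fact_r rho_bound_def algebra_simps)
  \<comment> \<open>A zero denominator makes the quotient 0 by convention; nonnegativity of the
    bound covers this case.\<close>
  have "0 \<le> rho_bound r" using r by (simp add: rho_bound_def)
  with le S0 have "rayleigh_quotient r H x \<le> rho_bound r"
    by (cases "?S = 0") (simp_all add: rayleigh_quotient_def divide_le_eq)
  then show ?thesis using xs by simp
qed

section \<open>Labellings from a maximizer of the Rayleigh quotient\<close>

text \<open>Connectedness without walks, see \<open>crossing_if_connected\<close>.\<close>

definition crossing :: "'a hypergraph \<Rightarrow> bool" where
  "crossing H \<longleftrightarrow> (\<forall>Z. Z \<subseteq> verts H \<and> Z \<noteq> {} \<and> Z \<noteq> verts H \<longrightarrow>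
     (\<exists>e\<in>edges H. e \<inter> Z \<noteq> {} \<and> e - Z \<noteq> {}))"

text \<open>A walk from \<open>Z\<close> to a vertex outside has a step leaving \<open>Z\<close>,
  and the edge of that step crosses.\<close>

lemma crossing_if_connected:
  assumes "connected_hypergraph H"
  shows "crossing H"
  unfolding crossing_def
proof (intro allI impI, elim conjE)
  fix Z assume Z: "Z \<subseteq> verts H" "Z \<noteq> {}" "Z \<noteq> verts H"
  then obtain u w where u: "u \<in> Z" and w: "w \<in> verts H" "w \<notin> Z" by blast
  then obtain vs es where W: "walk H vs es" and ends: "hd vs = u" "last vs = w"
    using assms Z unfolding connected_hypergraph_def by blast
  have len: "length vs = Suc (length es)" using W by (simp add: walk_def)
  then have ne: "vs \<noteq> []" by auto
  have "\<exists>i<length es. vs ! i \<in> Z \<and> vs ! Suc i \<notin> Z"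
  proof (rule ccontr)
    assume no: "\<not> ?thesis"
    have "vs ! i \<in> Z" if "i \<le> length es" for i
      using that
    proof (induction i)
      case 0
      then show ?case using ends u ne by (simp add: hd_conv_nth)
    next
      case (Suc i)
      then show ?case using no by auto
    qed
    then have "last vs \<in> Z" using ne len by (simp add: last_conv_nth)
    then show False using ends w by simp
  qed
  then obtain i where i: "i < length es" "vs ! i \<in> Z" "vs ! Suc i \<notin> Z" by blast
  then have "es ! i \<in> edges H" "vs ! i \<in> es ! i" "vs ! Suc i \<in> es ! i"
    using W by (auto simp: walk_def)
  then show "\<exists>e\<in>edges H. e \<inter> Z \<noteq> {} \<and> e - Z \<noteq> {}" using i by blast
qed

text \<open>If the zero set \<open>Z\<close> is nonempty, some edge \<open>e0\<close> crosses it.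
  Raising all zeros to a small \<open>t\<close> adds at least \<open>c * t ^ k\<close> with
  \<open>k < r\<close> to the edge sum, but only \<open>m * t ^ r\<close> to the power sum, so the
  quotient would exceed its maximum.\<close>

lemma rayleigh_maximizer_pos:
  assumes H: "uniform_hypergraph r H" and r: "2 \<le> r" and cr: "crossing H"
    and x: "nonneg_vector H x" and max: "rayleigh_quotient r H x = spectral_radius r H"
    and v: "v \<in> verts H"
  shows "0 < x v"
proof (rule ccontr)
  assume "\<not> 0 < x v"
  note H' = uniform_hypergraphD[OF H]
  have nn: "\<And>u. u \<in> verts H \<Longrightarrow> 0 \<le> x u" using x by (simp add: nonneg_vector_def)
  define Z where "Z = {u \<in> verts H. x u = 0}"
  have "v \<in> Z" using \<open>\<not> 0 < x v\<close> v nn[OF v] by (simp add: Z_def)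
  moreover obtain w where w: "w \<in> verts H" "w \<notin> Z"
    using x by (auto simp: Z_def nonneg_vector_def)
  ultimately have "Z \<subseteq> verts H" "Z \<noteq> {}" "Z \<noteq> verts H" by (auto simp: Z_def)
  then obtain e0 where e0: "e0 \<in> edges H" "e0 \<inter> Z \<noteq> {}" "e0 - Z \<noteq> {}"
    using cr unfolding crossing_def by meson
  define N where "N y = (\<Sum>e\<in>edges H. \<Prod>u\<in>e. y u)" for y :: "'a \<Rightarrow> real"
  define S where "S y = (\<Sum>u\<in>verts H. y u ^ r)" for y :: "'a \<Rightarrow> real"
  define y where "y t u = (if u \<in> Z then t else x u)" for t :: real and u
  define c where "c = (\<Prod>u\<in>e0 - Z. x u)"
  define k where "k = card (e0 \<inter> Z)"
  define m where "m = card Z"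
  have c: "0 < c"
    unfolding c_def
  proof (intro prod_pos)
    fix u assume "u \<in> e0 - Z"
    then have "u \<in> verts H" "x u \<noteq> 0" using H'(3)[OF e0(1)] by (auto simp: Z_def)
    then show "0 < x u" using nn[of u] by simp
  qed
  have finZ: "finite Z" using H'(1) by (simp add: Z_def)
  have k: "k < r"
  proof -
    have "e0 \<inter> Z \<subset> e0" using e0 by blast
    then have "k < card e0" unfolding k_def using H'(5)[OF e0(1)] by (rule psubset_card_mono[rotated])
    then show ?thesis using H'(4)[OF e0(1)] by simp
  qed
  have xpos: "0 < x w" using w nn[of w] by (simp add: Z_def)
  have Sx: "0 < S x"
    unfolding S_def using H'(1) w(1) xpos nn by (intro sum_pos2[of _ w]) auto
  have Nx: "0 \<le> N x"
    unfolding N_def using H'(3) nn by (intro sum_nonneg prod_nonneg) blast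
  have yb: "nonneg_vector H (y t)" if "0 < t" for t
    using that nn w xpos by (auto simp: nonneg_vector_def y_def intro!: bexI[of _ w])
  have Sy: "S (y t) = S x + m * t ^ r" for t :: real
  proof -
    have "S (y t) = (\<Sum>u\<in>Z. y t u ^ r) + (\<Sum>u\<in>verts H - Z. y t u ^ r)"
      unfolding S_def using H'(1) sum.subset_diff[of Z "verts H" "\<lambda>u. y t u ^ r"]
      by (auto simp: Z_def)
    also have "(\<Sum>u\<in>Z. y t u ^ r) = m * t ^ r" by (simp add: y_def m_def)
    also have "(\<Sum>u\<in>verts H - Z. y t u ^ r) = (\<Sum>u\<in>verts H. x u ^ r)"
      using H'(1) r by (intro sum.mono_neutral_cong_left) (auto simp: y_def Z_def)
    finally show ?thesis by (simp add: S_def)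
  qed
  have Ny: "N x + c * t ^ k \<le> N (y t)" if t: "0 < t" for t
  proof -
    have xy: "(\<Prod>u\<in>e. x u) \<le> (\<Prod>u\<in>e. y t u)" if e: "e \<in> edges H" for e
      using H'(3)[OF e] nn t by (intro prod_mono) (auto simp: y_def Z_def)
    have zero: "(\<Prod>u\<in>e0. x u) = 0"
      using e0 H'(5)[OF e0(1)] by (auto simp: Z_def)
    have "(\<Prod>u\<in>e0. y t u) = (\<Prod>u\<in>e0 - Z. y t u) * (\<Prod>u\<in>e0 \<inter> Z. y t u)"
      using prod.subset_diff[of "e0 \<inter> Z" e0 "y t"] H'(5)[OF e0(1)] by (simp add: Diff_Int)
    also have "\<dots> = c * t ^ k" by (simp add: y_def c_def k_def)
    finally have e0y: "(\<Prod>u\<in>e0. y t u) = c * t ^ k" .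
    have "N x + c * t ^ k = (\<Sum>e\<in>edges H - {e0}. \<Prod>u\<in>e. x u) + c * t ^ k"
      using zero H'(2) e0(1) by (simp add: N_def sum.remove)
    also have "\<dots> \<le> (\<Sum>e\<in>edges H - {e0}. \<Prod>u\<in>e. y t u) + c * t ^ k"
      by (intro add_right_mono sum_mono) (use xy in auto)
    also have "\<dots> = N (y t)" using e0y H'(2) e0(1) by (simp add: N_def sum.remove)
    finally show ?thesis .
  qed
  \<comment> \<open>The bound 1 gives \<open>t ^ r \<le> t * t ^ k\<close>. The other bound is
    chosen to make \<open>N x * m * t < c * S x\<close>; the summand 1 keeps the divisor
    positive.\<close>
  define t where "t = min 1 (c * S x / (2 * (N x * m + 1)))"
  have den: "0 < 2 * (N x * m + 1)" using Nx by (simp add: add_nonneg_pos)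
  have t: "0 < t" "t \<le> 1" using c Sx den by (auto simp: t_def)
  have "rayleigh_quotient r H (y t) \<le> rayleigh_quotient r H x"
    using spectral_radius_is_max(2)[OF H _ _ yb[OF t(1)]] r v max by auto
  moreover have Syp: "0 < S (y t)" using Sy Sx t by (simp add: add_pos_nonneg)
  ultimately have "N (y t) * S x \<le> N x * S (y t)"
    using Sx by (simp add: rayleigh_quotient_def N_def[symmetric] S_def[symmetric] field_simps)
  moreover have "(N x + c * t ^ k) * S x \<le> N (y t) * S x"
    using Ny[OF t(1)] Sx by simp
  ultimately have "c * t ^ k * S x \<le> N x * m * t ^ r"
    unfolding Sy by (simp add: algebra_simps)
  also have "\<dots> \<le> N x * m * (t * t ^ k)"
  proof (intro mult_left_mono)
    have "t ^ r \<le> t ^ Suc k" by (rule power_decreasing) (use k t in auto)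
    then show "t ^ r \<le> t * t ^ k" by simp
  qed (use Nx in auto)
  finally have "(c * S x) * t ^ k \<le> (N x * m * t) * t ^ k" by (simp add: algebra_simps)
  then have "c * S x \<le> N x * m * t" using t by simp
  also have "\<dots> < (N x * m + 1) * t" using t by (simp add: algebra_simps)
  also have "\<dots> \<le> (N x * m + 1) * (c * S x / (2 * (N x * m + 1)))"
    using den by (intro mult_left_mono) (auto simp: t_def)
  also have "\<dots> = c * S x / 2"
  proof -
    have "q * (z / (2 * q)) = z / 2" if "0 < q" for q z :: real using that by simp
    moreover have "0 < N x * m + 1" using den by (subst (asm) zero_less_mult_iff) simp
    ultimately show ?thesis by blast
  qed
  also have "\<dots> < c * S x" using c Sx by simp
  finally show False .
qed

text \<open>Only the coordinate at \<open>v\<close> varies: the edge sum is affine in it and the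
  power sum is \<open>t ^ r + D\<close>. The claim is the vanishing derivative at an interior
  minimum, multiplied by \<open>x v\<close>, which completes the products over
  \<open>e - {v}\<close> to products over \<open>e\<close>.\<close>

lemma rayleigh_maximizer_stationary:
  assumes H: "uniform_hypergraph r H" and r: "1 \<le> r"
    and pos: "\<And>u. u \<in> verts H \<Longrightarrow> 0 < x u"
    and max: "rayleigh_quotient r H x = spectral_radius r H"
    and v: "v \<in> verts H"
  shows "fact (r - 1) * (\<Sum>e | e \<in> edges H \<and> v \<in> e. \<Prod>u\<in>e. x u) = spectral_radius r H * x v ^ r"
proof -
  note H' = uniform_hypergraphD[OF H]
  let ?E = "{e \<in> edges H. v \<in> e}" and ?\<rho> = "spectral_radius r H"
  define A where "A = (\<Sum>e\<in>?E. \<Prod>u\<in>e - {v}. x u)"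
  define C where "C = (\<Sum>e\<in>edges H - ?E. \<Prod>u\<in>e. x u)"
  define D where "D = (\<Sum>u\<in>verts H - {v}. x u ^ r)"
  have "(\<Sum>e\<in>?E. \<Prod>u\<in>e. (x(v := t)) u) = (\<Sum>e\<in>?E. t * (\<Prod>u\<in>e - {v}. x u))" for t
  proof (rule sum.cong[OF refl])
    fix e assume "e \<in> ?E"
    then have "finite e" "v \<in> e" using H'(5) by auto
    then have "(\<Prod>u\<in>e. (x(v := t)) u) = t * (\<Prod>u\<in>e - {v}. (x(v := t)) u)"
      by (simp add: prod.remove)
    also have "(\<Prod>u\<in>e - {v}. (x(v := t)) u) = (\<Prod>u\<in>e - {v}. x u)"
      by (rule prod.cong) auto
    finally show "(\<Prod>u\<in>e. (x(v := t)) u) = t * (\<Prod>u\<in>e - {v}. x u)" .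
  qed
  then have star: "(\<Sum>e\<in>?E. \<Prod>u\<in>e. (x(v := t)) u) = t * A" for t
    by (simp add: A_def sum_distrib_left)
  have N: "(\<Sum>e\<in>edges H. \<Prod>u\<in>e. (x(v := t)) u) = t * A + C" for t
  proof -
    have "(\<Sum>e\<in>edges H. \<Prod>u\<in>e. (x(v := t)) u)
        = (\<Sum>e\<in>edges H - ?E. \<Prod>u\<in>e. (x(v := t)) u) + (\<Sum>e\<in>?E. \<Prod>u\<in>e. (x(v := t)) u)"
      by (rule sum.subset_diff) (use H'(2) in auto)
    also have "(\<Sum>e\<in>edges H - ?E. \<Prod>u\<in>e. (x(v := t)) u) = C"
      unfolding C_def by (intro sum.cong prod.cong) auto
    finally show ?thesis using star by simp
  qed
  have S: "(\<Sum>u\<in>verts H. (x(v := t)) u ^ r) = t ^ r + D" for t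
  proof -
    have "(\<Sum>u\<in>verts H. (x(v := t)) u ^ r) = t ^ r + (\<Sum>u\<in>verts H - {v}. (x(v := t)) u ^ r)"
      using H'(1) v by (simp add: sum.remove)
    also have "(\<Sum>u\<in>verts H - {v}. (x(v := t)) u ^ r) = D"
      unfolding D_def by (rule sum.cong) auto
    finally show ?thesis .
  qed
  have D: "0 \<le> D" unfolding D_def using pos by (intro sum_nonneg) (auto intro!: less_imp_le)
  \<comment> \<open>The gap to the maximum with the denominator cleared: a polynomial in
    \<open>t\<close>, nonnegative for positive \<open>t\<close> and zero at
    \<open>x v\<close>.\<close>
  define h where "h t = ?\<rho> * (t ^ r + D) - fact r * (t * A + C)" for t
  have h_eq: "h t = (?\<rho> - rayleigh_quotient r H (x(v := t))) * (t ^ r + D)" if "0 < t" for t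
  proof -
    have "t ^ r + D \<noteq> 0" using D that by (simp add: add_pos_nonneg less_imp_neq[symmetric])
    then have "z / (t ^ r + D) * (t ^ r + D) = z" for z by simp
    then show ?thesis unfolding rayleigh_quotient_def N S h_def left_diff_distrib by simp
  qed
  have xv: "0 < x v" using pos v by simp
  have h0: "h (x v) = 0" using h_eq[OF xv] max by simp
  have h_nonneg: "0 \<le> h t" if "0 < t" for t
  proof -
    have "nonneg_vector H (x(v := t))"
      using pos that v by (auto simp: nonneg_vector_def less_imp_le intro!: bexI[of _ v])
    then have "rayleigh_quotient r H (x(v := t)) \<le> ?\<rho>"
      using spectral_radius_is_max(2)[OF H r] v by auto
    then show ?thesis unfolding h_eq[OF that] using D that by (intro mult_nonneg_nonneg) auto
  qed
  have "(h has_real_derivative ?\<rho> * (r * x v ^ (r - 1)) - fact r * A) (at (x v))"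
    unfolding h_def by (auto intro!: derivative_eq_intros)
  then have "?\<rho> * (r * x v ^ (r - 1)) - fact r * A = 0"
  proof (rule DERIV_local_min[OF _ xv])
    show "\<forall>y. \<bar>x v - y\<bar> < x v \<longrightarrow> h (x v) \<le> h y"
      using h0 h_nonneg by auto
  qed
  then have "r * (?\<rho> * x v ^ (r - 1)) = r * (fact (r - 1) * A)"
    using r by (simp add: fact_reduce algebra_simps)
  then have "?\<rho> * x v ^ (r - 1) = fact (r - 1) * A" using r by simp
  then have "?\<rho> * (x v * x v ^ (r - 1)) = fact (r - 1) * (x v * A)"
    by (metis mult.left_commute)
  also have "x v * x v ^ (r - 1) = x v ^ r" using r by (simp flip: power_Suc)
  also have "x v * A = (\<Sum>e\<in>?E. \<Prod>u\<in>e. x u)" using star[of "x v"] by simp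
  finally show ?thesis by simp
qed

lemma normal_labelling_if_spectral_radius_le:
  assumes H: "uniform_hypergraph r H" and r: "2 \<le> r" and cr: "crossing H"
    and ne: "edges H \<noteq> {}" and le: "spectral_radius r H \<le> rho_bound r"
  shows "\<exists>B. normal_labelling H B"
proof -
  note H' = uniform_hypergraphD[OF H]
  have r1: "1 \<le> r" using r by simp
  obtain e0 where e0: "e0 \<in> edges H" using ne by blast
  then have "e0 \<noteq> {}" using H'(4) r by fastforce
  then have V: "verts H \<noteq> {}" using H'(3)[OF e0] by blast
  obtain x where x: "nonneg_vector H x" and max: "rayleigh_quotient r H x = spectral_radius r H"
    using spectral_radius_is_max(1)[OF H r1 V] by blast
  have pos: "0 < x v" if "v \<in> verts H" for v
    by (rule rayleigh_maximizer_pos[OF H r cr x max that])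
  define P where "P e = (\<Prod>u\<in>e. x u)" for e
  let ?\<rho> = "spectral_radius r H"
  have P: "0 < P e" if "e \<in> edges H" for e
    unfolding P_def using H'(3)[OF that] pos by (intro prod_pos) auto
  have "0 < rayleigh_quotient r H x"
    unfolding rayleigh_quotient_def P_def[symmetric]
    using P pos V ne H' by (intro divide_pos_pos mult_pos_pos sum_pos) auto
  then have \<rho>: "0 < ?\<rho>" using max by simp
  \<comment> \<open>Stationarity makes the labels at a vertex sum to exactly 1. In the product over
    an edge the entries of \<open>x\<close> cancel, and \<open>(fact (r - 1) / ?\<rho>) ^ r\<close>
    remains.\<close>
  define B where "B v e = fact (r - 1) * P e / (?\<rho> * x v ^ r)" for v e
  have "0 < B v e" if "e \<in> edges H" "v \<in> e" for v e
  proof -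
    have "0 < x v" using that H'(3) pos by blast
    then show ?thesis using P[OF that(1)] \<rho> by (simp add: B_def)
  qed
  moreover have "(\<Sum>e | e \<in> edges H \<and> v \<in> e. B v e) \<le> 1" if v: "v \<in> verts H" for v
  proof -
    have "(\<Sum>e | e \<in> edges H \<and> v \<in> e. B v e)
        = fact (r - 1) * (\<Sum>e | e \<in> edges H \<and> v \<in> e. P e) / (?\<rho> * x v ^ r)"
      unfolding B_def by (simp add: sum_distrib_left sum_divide_distrib)
    also have "\<dots> = 1"
      using rayleigh_maximizer_stationary[OF H r1 pos max v] \<rho> pos[OF v] by (simp add: P_def)
    finally show ?thesis by simp
  qed
  moreover have "1 / 4 \<le> (\<Prod>v\<in>e. B v e)" if e: "e \<in> edges H" for e
  proof -
    have "(\<Prod>v\<in>e. B v e) = (fact (r - 1) * P e) ^ r / (\<Prod>v\<in>e. ?\<rho> * x v ^ r)"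
      unfolding B_def by (simp add: prod_dividef H'(4)[OF e])
    also have "(\<Prod>v\<in>e. ?\<rho> * x v ^ r) = ?\<rho> ^ r * P e ^ r"
      by (simp add: prod.distrib prod_power_distrib P_def H'(4)[OF e])
    also have "(fact (r - 1) * P e) ^ r / (?\<rho> ^ r * P e ^ r) = (fact (r - 1)) ^ r / ?\<rho> ^ r"
      using P[OF e] by (simp add: power_mult_distrib)
    finally have eq: "(\<Prod>v\<in>e. B v e) = fact (r - 1) ^ r / ?\<rho> ^ r" .
    have "?\<rho> ^ r \<le> rho_bound r ^ r" using le \<rho> by (intro power_mono) auto
    also have "\<dots> = fact (r - 1) ^ r * 4" using r by (simp add: rho_bound_def power_mult_distrib)
    finally show ?thesis unfolding eq using \<rho> by (simp add: field_simps)
  qed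
  ultimately have "normal_labelling H B" by (simp add: normal_labelling_def)
  then show ?thesis by blast
qed

section \<open>Connected components\<close>

text \<open>Closed parts are the unions of connected components. Taking a component to be the least
  closed part containing a vertex avoids walks, and leastness is what yields
  \<open>crossing\<close>.\<close>

definition closed_part :: "'a hypergraph \<Rightarrow> 'a set \<Rightarrow> bool" where
  "closed_part H U \<longleftrightarrow> U \<subseteq> verts H \<and> (\<forall>e\<in>edges H. e \<subseteq> U \<or> e \<inter> U = {})"

definition component :: "'a hypergraph \<Rightarrow> 'a \<Rightarrow> 'a set" where
  "component H v = \<Inter> {U. closed_part H U \<and> v \<in> U}"

definition restrict_hypergraph :: "'a hypergraph \<Rightarrow> 'a set \<Rightarrow> 'a hypergraph" where
  "restrict_hypergraph H U = \<lparr>verts = U, edges = {e \<in> edges H. e \<subseteq> U}\<rparr>"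

text \<open>If no edge of the component \<open>?C\<close> crossed a proper nonempty
  \<open>Z\<close>, then \<open>Z\<close> and \<open>?C - Z\<close> would both be closed, and the
  one containing \<open>v\<close> would contradict minimality.\<close>

lemma component_properties:
  assumes H: "uniform_hypergraph r H" and v: "v \<in> verts H"
  shows "v \<in> component H v" "closed_part H (component H v)"
    "crossing (restrict_hypergraph H (component H v))"
proof -
  let ?C = "component H v"
  have V: "closed_part H (verts H)"
    using H by (auto simp: closed_part_def uniform_hypergraph_def)
  show vC: "v \<in> ?C" by (simp add: component_def)
  have CV: "?C \<subseteq> verts H" using V v by (auto simp: component_def)
  have "e \<subseteq> ?C \<or> e \<inter> ?C = {}" if e: "e \<in> edges H" for e
  proof (cases "\<forall>U. closed_part H U \<and> v \<in> U \<longrightarrow> e \<subseteq> U")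
    case True
    then show ?thesis by (auto simp: component_def)
  next
    case False
    then obtain U where "closed_part H U" "v \<in> U" "\<not> e \<subseteq> U" by blast
    then have "e \<inter> U = {}" "?C \<subseteq> U" using e by (auto simp: closed_part_def component_def)
    then show ?thesis by blast
  qed
  with CV show cC: "closed_part H ?C" by (simp add: closed_part_def)
  have minimal: "?C \<subseteq> W" if "closed_part H W" "v \<in> W" for W
    using that by (auto simp: component_def)
  show "crossing (restrict_hypergraph H ?C)"
    unfolding crossing_def restrict_hypergraph_def
  proof (intro allI impI, elim conjE, rule ccontr)
    fix Z assume Z: "Z \<subseteq> verts \<lparr>verts = ?C, edges = {e \<in> edges H. e \<subseteq> ?C}\<rparr>" "Z \<noteq> {}"
      "Z \<noteq> verts \<lparr>verts = ?C, edges = {e \<in> edges H. e \<subseteq> ?C}\<rparr>"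
      and "\<not> (\<exists>e\<in>edges \<lparr>verts = ?C, edges = {e \<in> edges H. e \<subseteq> ?C}\<rparr>. e \<inter> Z \<noteq> {} \<and> e - Z \<noteq> {})"
    then have no: "\<And>e. e \<in> edges H \<Longrightarrow> e \<subseteq> ?C \<Longrightarrow> e \<inter> Z = {} \<or> e \<subseteq> Z"
      and Z: "Z \<subseteq> ?C" "Z \<noteq> {}" "Z \<noteq> ?C" by auto
    have *: "e \<inter> ?C = {} \<or> e \<subseteq> ?C" if "e \<in> edges H" for e
      using cC that by (auto simp: closed_part_def)
    have cases: "e \<inter> ?C = {} \<or> e \<subseteq> ?C \<and> e \<inter> Z = {} \<or> e \<subseteq> Z" if "e \<in> edges H" for e
      using *[OF that] no[OF that] by argo
    have "e \<subseteq> Z \<or> e \<inter> Z = {}" "e \<subseteq> ?C - Z \<or> e \<inter> (?C - Z) = {}" if "e \<in> edges H" for e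
      using cases[OF that] Z(1) by auto
    then have "closed_part H Z" "closed_part H (?C - Z)"
      using CV Z(1) by (auto simp: closed_part_def)
    then show False using minimal[of Z] minimal[of "?C - Z"] vC Z by blast
  qed
qed

text \<open>A maximizer on \<open>U\<close>, extended by 0, has the same quotient on
  \<open>H\<close>: an edge outside the restriction is disjoint from \<open>U\<close> and nonempty,
  so its product vanishes.\<close>

lemma spectral_radius_restrict_le:
  assumes H: "uniform_hypergraph r H" and r: "1 \<le> r" and U: "closed_part H U" "U \<noteq> {}"
  shows "uniform_hypergraph r (restrict_hypergraph H U)"
    and "spectral_radius r (restrict_hypergraph H U) \<le> spectral_radius r H"
proof -
  let ?K = "restrict_hypergraph H U"
  note H' = uniform_hypergraphD[OF H]
  have UV: "U \<subseteq> verts H" using U by (simp add: closed_part_def)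
  show K: "uniform_hypergraph r ?K"
    using H' finite_subset[OF UV] by (auto simp: uniform_hypergraph_def restrict_hypergraph_def)
  have "verts ?K \<noteq> {}" using U by (simp add: restrict_hypergraph_def)
  then obtain x where x: "nonneg_vector ?K x"
      and max: "rayleigh_quotient r ?K x = spectral_radius r ?K"
    using spectral_radius_is_max(1)[OF K r] by blast
  define y where "y v = (if v \<in> U then x v else 0)" for v
  have y: "nonneg_vector H y"
    using x UV by (auto simp: nonneg_vector_def y_def restrict_hypergraph_def)
  have "(\<Sum>e\<in>edges H. \<Prod>v\<in>e. y v) = (\<Sum>e\<in>edges ?K. \<Prod>v\<in>e. x v)"
  proof (rule sum.mono_neutral_cong_right)
    show "\<forall>e\<in>edges H - edges ?K. (\<Prod>v\<in>e. y v) = 0"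
    proof
      fix e assume e: "e \<in> edges H - edges ?K"
      then have "e \<inter> U = {}" using U by (auto simp: closed_part_def restrict_hypergraph_def)
      moreover have "card e = r" using e H'(4) by simp
      then have "e \<noteq> {}" using r by auto
      then obtain v where "v \<in> e" by blast
      ultimately show "(\<Prod>v\<in>e. y v) = 0" using e H'(5) by (auto simp: y_def)
    qed
    show "(\<Prod>v\<in>e. y v) = (\<Prod>v\<in>e. x v)" if "e \<in> edges ?K" for e
      using that by (intro prod.cong) (auto simp: y_def restrict_hypergraph_def)
  qed (auto simp: H' restrict_hypergraph_def)
  moreover have "(\<Sum>v\<in>verts H. y v ^ r) = (\<Sum>v\<in>verts ?K. x v ^ r)"
    using H' UV r by (intro sum.mono_neutral_cong_right) (auto simp: y_def restrict_hypergraph_def)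
  ultimately have "rayleigh_quotient r H y = rayleigh_quotient r ?K x"
    by (simp add: rayleigh_quotient_def)
  then show "spectral_radius r ?K \<le> spectral_radius r H"
    using spectral_radius_is_max(2)[OF H r _ y] U(2) UV max by auto
qed

section \<open>Bounds on labels and the case of edges with at least five vertices\<close>

lemma normal_labellingD:
  assumes "normal_labelling H B"
  shows "e \<in> edges H \<Longrightarrow> v \<in> e \<Longrightarrow> 0 < B v e" "e \<in> edges H \<Longrightarrow> v \<in> e \<Longrightarrow> 0 \<le> B v e"
    "v \<in> verts H \<Longrightarrow> (\<Sum>e | e \<in> edges H \<and> v \<in> e. B v e) \<le> 1"
    "e \<in> edges H \<Longrightarrow> 1 / 4 \<le> (\<Prod>v\<in>e. B v e)"
  using assms by (auto simp: normal_labelling_def less_imp_le)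

lemma sum_normal_labels_le:
  assumes H: "uniform_hypergraph r H" and B: "normal_labelling H B"
    and v: "v \<in> verts H" and G: "\<And>g. g \<in> G \<Longrightarrow> g \<in> edges H \<and> v \<in> g"
  shows "(\<Sum>g\<in>G. B v g) \<le> 1"
proof -
  have "(\<Sum>g\<in>G. B v g) \<le> (\<Sum>g | g \<in> edges H \<and> v \<in> g. B v g)"
  proof (rule sum_mono2)
    show "finite {g. g \<in> edges H \<and> v \<in> g}" using uniform_hypergraphD(2)[OF H] by simp
    show "0 \<le> B v g" if "g \<in> {g. g \<in> edges H \<and> v \<in> g} - G" for g
      using that normal_labellingD(2)[OF B] by blast
  qed (use G in blast)
  then show ?thesis using normal_labellingD(3)[OF B v] by linarith
qed

text \<open>A label is one summand of a vertex sum, hence at most 1. The other factors of an edge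
  product can then only shrink it, so each factor is at least 1/4.\<close>

lemma normal_label_bounds:
  assumes H: "uniform_hypergraph r H" and B: "normal_labelling H B"
    and e: "e \<in> edges H" "v \<in> e"
  shows "B v e \<le> 1" "1 / 4 \<le> B v e"
proof -
  note H' = uniform_hypergraphD[OF H]
  have le1: "B u e \<le> 1" if "u \<in> e" for u
    using sum_normal_labels_le[OF H B, of u "{e}"] H'(3) e(1) that by auto
  then show "B v e \<le> 1" using e by simp
  have "1 / 4 \<le> B v e * (\<Prod>u\<in>e - {v}. B u e)"
    using normal_labellingD(4)[OF B e(1)] H'(5)[OF e(1)] e(2) by (simp add: prod.remove[of e v])
  also have "\<dots> \<le> B v e * 1"
  proof (intro mult_left_mono prod_le_1)
    show "0 \<le> B u e \<and> B u e \<le> 1" if "u \<in> e - {v}" for u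
      using that le1 normal_labellingD(2)[OF B e(1)] by blast
  qed (rule normal_labellingD(2)[OF B e])
  finally show "1 / 4 \<le> B v e" by simp
qed

lemma normal_labelling_imp_reducible:
  assumes H: "uniform_hypergraph r H" and r: "5 \<le> r" and B: "normal_labelling H B"
  shows "reducible H"
proof (rule ccontr)
  assume "\<not> reducible H"
  then obtain e where e: "e \<in> edges H" and nl: "\<And>v. v \<in> e \<Longrightarrow> \<not> leaf_vertex H v"
    by (auto simp: reducible_def)
  note H' = uniform_hypergraphD[OF H]
  have "B v e \<le> 3 / 4" if v: "v \<in> e" for v
  proof -
    obtain g where g: "g \<in> edges H" "v \<in> g" "g \<noteq> e"
      using nl[OF v] v e H'(3)[OF e] unfolding leaf_vertex_def by blast
    have "v \<in> verts H" using v e H'(3) by blast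
    then have "B v e + B v g \<le> 1"
      using sum_normal_labels_le[OF H B, of v "{e, g}"] g e v by auto
    then show ?thesis using normal_label_bounds(2)[OF H B g(1,2)] by simp
  qed
  then have "(\<Prod>v\<in>e. B v e) \<le> (\<Prod>v\<in>e. 3 / 4)"
    using normal_labellingD(2)[OF B e] by (intro prod_mono) blast
  also have "\<dots> = (3 / 4) ^ r" using H'(4)[OF e] by simp
  also have "\<dots> \<le> (3 / 4 :: real) ^ 5" using r by (intro power_decreasing) auto
  also have "\<dots> < 1 / 4" by (simp add: eval_nat_numeral)
  finally have "(\<Prod>v\<in>e. B v e) < 1 / 4" .
  moreover have "1 / 4 \<le> (\<Prod>v\<in>e. B v e)" using B e by (simp add: normal_labelling_def)
  ultimately show False by linarith
qed

text \<open>\<open>H\<close> may be disconnected, so a labelling is constructed only on the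
  component \<open>U\<close> of a vertex of the leafless edge \<open>e\<close>. Every edge through a
  vertex of \<open>U\<close> lies in \<open>U\<close>, so leaves of the restriction are leaves of
  \<open>H\<close>.\<close>

lemma reducible_if_spectral_radius_le:
  assumes H: "uniform_hypergraph r H" and r: "5 \<le> r" and le: "spectral_radius r H \<le> rho_bound r"
  shows "reducible H"
proof (rule ccontr)
  assume "\<not> reducible H"
  then obtain e where e: "e \<in> edges H" and nl: "\<And>v. v \<in> e \<Longrightarrow> \<not> leaf_vertex H v"
    by (auto simp: reducible_def)
  note H' = uniform_hypergraphD[OF H]
  obtain v where v: "v \<in> e" using H'(4)[OF e] r by fastforce
  then have vV: "v \<in> verts H" using H'(3)[OF e] by blast
  define U where "U = component H v"
  note C = component_properties[OF H vV, folded U_def]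
  have U: "closed_part H U" "U \<noteq> {}" using C by auto
  have r1: "1 \<le> r" "2 \<le> r" using r by auto
  let ?K = "restrict_hypergraph H U"
  note K = spectral_radius_restrict_le[OF H r1(1) U]
  have eU: "e \<subseteq> U" using C v e by (auto simp: closed_part_def)
  then have eK: "e \<in> edges ?K" using e by (simp add: restrict_hypergraph_def)
  have "g \<subseteq> U" if "g \<in> edges H" "u \<in> g" "u \<in> U" for g u
    using C(2) that by (auto simp: closed_part_def)
  then have inc: "f \<in> edges ?K \<and> u \<in> f \<longleftrightarrow> f \<in> edges H \<and> u \<in> f" if "u \<in> U" for f u
    using that by (auto simp: restrict_hypergraph_def)
  have verts: "verts ?K = U" "U \<subseteq> verts H"
    using U(1) by (simp_all add: restrict_hypergraph_def closed_part_def)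
  have leaf: "leaf_vertex H u" if "leaf_vertex ?K u" for u
  proof -
    have "u \<in> U" using that verts by (simp add: leaf_vertex_def)
    then show ?thesis using that inc verts by (simp add: leaf_vertex_def subset_eq)
  qed
  obtain B where "normal_labelling ?K B"
    using normal_labelling_if_spectral_radius_le[OF K(1) r1(2) C(3)] eK K(2) le by auto
  then have "reducible ?K" by (rule normal_labelling_imp_reducible[OF K(1) r])
  then show False using eK nl leaf by (auto simp: reducible_def)
qed

section \<open>The bound for pendant paths attached to a central edge\<close>

text \<open>The label at the attaching vertex of the last \<open>l\<close> edges of a pendant path all of whose
  inequalities are tight: it solves \<open>x 0 = 0\<close>, \<open>x (l + 1) * (1 - x l) = 1 / 4\<close>.\<close>

definition path_label :: "nat \<Rightarrow> real" where
  "path_label l = l / (2 * (l + 1))"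

lemma path_label_bounds: "0 \<le> path_label l" "0 < l \<Longrightarrow> 0 < path_label l" "path_label l < 1 / 2"
  by (auto simp: path_label_def field_simps)

lemma path_label_Suc: "path_label (Suc l) * (1 - path_label l) = 1 / 4"
proof -
  have eq: "1 - path_label l = (l + 2) / (2 * (l + 1))"
    by (simp add: path_label_def field_simps)
  have eq': "path_label (Suc l) = (l + 1) / (2 * (l + 2))"
    by (simp add: path_label_def)
  have "a / (2 * b) * (b / (2 * a)) = 1 / 4" if "0 < a" "0 < b" for a b :: real
    using that by simp
  from this[of "l + 1" "l + 2"] show ?thesis unfolding eq eq' by simp
qed

lemma path_label_mono: "l \<le> m \<Longrightarrow> path_label l \<le> path_label m"
  by (simp add: path_label_def field_simps)

text \<open>Labels pull back along the bijection; its injectivity on vertices carries over to the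
  images of edges, so vertex sums and edge products are preserved.\<close>

lemma normal_labelling_iso:
  assumes H: "uniform_hypergraph r H" and iso: "hypergraph_iso H K" and B: "normal_labelling K B"
  shows "\<exists>B'. normal_labelling H B'"
proof -
  note H' = uniform_hypergraphD[OF H]
  obtain f where f: "bij_betw f (verts H) (verts K)" and fE: "image f ` edges H = edges K"
    using iso by (auto simp: hypergraph_iso_def)
  have inj: "inj_on f (verts H)" using f by (simp add: bij_betw_def)
  have inj_e: "inj_on f e" if "e \<in> edges H" for e
    using inj H'(3)[OF that] by (rule inj_on_subset)
  have mem: "f v \<in> f ` e \<longleftrightarrow> v \<in> e" if "e \<in> edges H" "v \<in> verts H" for v e
    using inj H'(3)[OF that(1)] that(2) by (auto simp: inj_on_def)
  have inj_E: "inj_on (image f) (edges H)"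
    by (rule inj_on_subset[OF inj_on_image_Pow[OF inj]]) (use H'(3) in auto)
  have fedge: "f ` e \<in> edges K" if "e \<in> edges H" for e using that fE by blast
  let ?B = "\<lambda>v e. B (f v) (f ` e)"
  have "normal_labelling H ?B"
    unfolding normal_labelling_def
  proof (intro conjI ballI)
    show "0 < ?B v e" if "e \<in> edges H" "v \<in> e" for v e
      using that B fedge by (auto simp: normal_labelling_def)
    show "1 / 4 \<le> (\<Prod>v\<in>e. ?B v e)" if "e \<in> edges H" for e
    proof -
      have "(\<Prod>v\<in>e. ?B v e) = (\<Prod>w\<in>f ` e. B w (f ` e))"
        using inj_e[OF that] by (simp add: prod.reindex)
      then show ?thesis using B fedge[OF that] by (simp add: normal_labelling_def)
    qed
    show "(\<Sum>e | e \<in> edges H \<and> v \<in> e. ?B v e) \<le> 1" if v: "v \<in> verts H" for v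
    proof -
      have "(\<Sum>e | e \<in> edges H \<and> v \<in> e. ?B v e)
          = (\<Sum>g\<in>image f ` {e \<in> edges H. v \<in> e}. B (f v) g)"
        by (subst sum.reindex) (auto intro: inj_on_subset[OF inj_E])
      also have "image f ` {e \<in> edges H. v \<in> e} = {g \<in> edges K. f v \<in> g}"
        using fE mem v by (auto simp flip: fE)
      finally show ?thesis using B f v by (auto simp: normal_labelling_def bij_betw_def)
    qed
  qed
  then show ?thesis by blast
qed

lemma H4_edge_inject: "H4_edge p s = H4_edge q t \<longleftrightarrow> p = q \<and> s = t"
proof
  assume eq: "H4_edge p s = H4_edge q t"
  have "(p, 3 * s) \<in> H4_edge q t" "(p, 3 * s + 3) \<in> H4_edge q t"
    unfolding eq[symmetric] by (auto simp: H4_edge_def)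
  then show "p = q \<and> s = t" by (auto simp: H4_edge_def)
qed simp

lemma H4_edge_neq_centre: "H4_edge p t \<noteq> H4_centre" "H4_centre \<noteq> H4_edge p t"
proof -
  have "(p, 3 * t + 3) \<in> H4_edge p t" "(p, 3 * t + 3) \<notin> H4_centre"
    by (auto simp: H4_edge_def H4_centre_def)
  then show "H4_edge p t \<noteq> H4_centre" "H4_centre \<noteq> H4_edge p t" by auto
qed

lemma less_4_iff: "p < 4 \<longleftrightarrow> p = 0 \<or> p = 1 \<or> p = 2 \<or> p = (3::nat)"
  by auto

lemma edges_H4:
  "edges (H4 i j k l) = insert H4_centre {H4_edge p t |p t. p < 4 \<and> t < [i, j, k, l] ! p}"
  by (auto simp: H4_def H4_branch_def)

lemma verts_H4: "verts (H4 i j k l) = {(p, n). p < 4 \<and> n \<le> 3 * [i, j, k, l] ! p}"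
  by (auto simp: H4_def)

text \<open>An explicit labelling: along the branches \<open>path_label_Suc\<close> makes every edge
  product exactly 1/4, and the central product is bounded by the assumption
  \<open>prod\<close>.\<close>

lemma spectral_radius_H4_le:
  fixes H :: "'a hypergraph"
  assumes H: "uniform_hypergraph 4 H" and ne: "verts H \<noteq> {}"
    and pos: "1 \<le> i" "1 \<le> j" "1 \<le> k" "1 \<le> l" and iso: "hypergraph_iso H (H4 i j k l)"
    and prod: "1 / 4 \<le> (1 - path_label i) * (1 - path_label j) * (1 - path_label k) * (1 - path_label l)"
  shows "spectral_radius 4 H \<le> rho_bound 4"
proof -
  define ls where "ls = [i, j, k, l]"
  let ?K = "H4 i j k l"
  note K = H4_pendant_paths[OF pos]
  \<comment> \<open>\<open>up v\<close> is the edge at \<open>v\<close> on the side of the centre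
    and \<open>low v\<close> the one on the far side; they agree when 3 does not divide the
    position. At the end of a branch \<open>low v\<close> is not an edge of \<open>?K\<close>, and
    there \<open>c v = path_label 0 = 0\<close>, so the label in \<open>up v\<close> is 1.\<close>
  define low where "low v = H4_edge (fst v) (snd v div 3)" for v :: "nat \<times> nat"
  define up where "up v = (if snd v = 0 then H4_centre else H4_edge (fst v) ((snd v - 1) div 3))"
    for v :: "nat \<times> nat"
  define c where "c v = (if 3 dvd snd v then path_label (ls ! fst v - snd v div 3) else 0)"
    for v :: "nat \<times> nat"
  define B where "B v e = (if 3 dvd snd v \<and> e = low v then c v else 1 - c v)"
    for v :: "nat \<times> nat" and e
  have c: "0 \<le> c v" "c v < 1 / 2" for v
    using path_label_bounds by (auto simp: c_def)
  have ls: "0 < ls ! p" if "p < 4" for p using that pos by (auto simp: ls_def less_4_iff)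
  have "normal_labelling ?K B"
    unfolding normal_labelling_def
  proof (intro conjI ballI)
    show "0 < B v e" if e: "e \<in> edges ?K" and v: "v \<in> e" for v e
    proof (cases "3 dvd snd v \<and> e = low v")
      case True
      then have "e \<noteq> H4_centre" by (simp add: low_def H4_edge_neq_centre)
      then obtain p t where "p < 4" "t < ls ! p" "e = H4_edge p t"
        using e by (auto simp: edges_H4 ls_def)
      with True have "fst v < 4" "snd v div 3 < ls ! fst v" by (auto simp: low_def H4_edge_inject)
      then show ?thesis using True by (simp add: B_def c_def path_label_bounds)
    next
      case False
      then show ?thesis using c(2)[of v] by (auto simp: B_def)
    qed
    show "1 / 4 \<le> (\<Prod>v\<in>e. B v e)" if e: "e \<in> edges ?K" for e
    proof (cases "e = H4_centre")
      case True
      have "B (p, 0) H4_centre = 1 - path_label (ls ! p)" for p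
        by (simp add: B_def low_def c_def H4_edge_neq_centre)
      then show ?thesis using prod by (simp add: True) (simp add: H4_centre_def ls_def mult.assoc)
    next
      case False
      then obtain p t where t: "p < 4" "t < ls ! p" "e = H4_edge p t"
        using e by (auto simp: edges_H4 ls_def)
      have e4: "e = {(p, 3 * t), (p, 3 * t + 1), (p, 3 * t + 2), (p, 3 * t + 3)}"
        unfolding t(3) H4_edge_def by (auto simp: numeral_eq_Suc le_Suc_eq)
      have "\<not> 3 dvd 3 * t + 1" "\<not> 3 dvd 3 * t + 2" by presburger+
      then have "B (p, 3 * t + 1) e = 1" "B (p, 3 * t + 2) e = 1"
        by (auto simp: B_def c_def)
      moreover have "B (p, 3 * t) e = path_label (ls ! p - t)"
        by (simp add: B_def c_def low_def t(3))
      moreover have "B (p, 3 * t + 3) e = 1 - path_label (ls ! p - Suc t)"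
        by (simp add: B_def c_def low_def t(3) H4_edge_inject)
      moreover have "path_label (ls ! p - t) * (1 - path_label (ls ! p - Suc t)) = 1 / 4"
        using path_label_Suc[of "ls ! p - Suc t"] t(2) by (simp add: Suc_diff_Suc)
      moreover have "(\<Prod>v\<in>e. B v e)
          = B (p, 3 * t) e * (B (p, 3 * t + 1) e * (B (p, 3 * t + 2) e * B (p, 3 * t + 3) e))"
        by (subst e4) simp
      ultimately show ?thesis by simp
    qed
    show "(\<Sum>e | e \<in> edges ?K \<and> v \<in> e. B v e) \<le> 1" if v: "v \<in> verts ?K" for v
    proof -
      have incident: "{e. e \<in> edges ?K \<and> v \<in> e} \<subseteq> {low v, up v}"
      proof
        fix e assume "e \<in> {e. e \<in> edges ?K \<and> v \<in> e}"
        then have e: "e \<in> edges ?K" "v \<in> e" by auto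
        show "e \<in> {low v, up v}"
        proof (cases "e = H4_centre")
          case True
          then have "snd v = 0" using e(2) by (auto simp: H4_centre_def)
          then show ?thesis using True by (simp add: up_def)
        next
          case False
          then obtain p t where t: "e = H4_edge p t" using e by (auto simp: edges_H4)
          with e have n: "fst v = p" "3 * t \<le> snd v" "snd v \<le> 3 * t + 3"
            by (auto simp: H4_edge_def)
          \<comment> \<open>The last position \<open>3 * t + 3\<close> of an edge reaches it through
            \<open>up\<close>, all others through \<open>low\<close>.\<close>
          then have "snd v div 3 = t \<or> (snd v \<noteq> 0 \<and> (snd v - 1) div 3 = t)"
            by (cases "snd v = 3 * t + 3") (auto intro: div_nat_eqI)
          then show ?thesis using t n by (auto simp: low_def up_def)
        qed
      qed
      have nonneg: "0 \<le> B v e" for e using c[of v] by (auto simp: B_def)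
      have "(\<Sum>e | e \<in> edges ?K \<and> v \<in> e. B v e) \<le> (\<Sum>e\<in>{low v, up v}. B v e)"
        by (rule sum_mono2[OF _ incident]) (use nonneg in auto)
      also have "\<dots> \<le> 1"
      proof (cases "low v = up v")
        case True
        then show ?thesis using c[of v] by (auto simp: B_def)
      next
        case False
        have "3 dvd snd v"
        proof (rule ccontr)
          assume "\<not> 3 dvd snd v"
          moreover have "n \<noteq> 0 \<and> (n - 1) div 3 = n div 3" if "\<not> 3 dvd n" for n :: nat
            using that by presburger
          ultimately have "snd v \<noteq> 0" "(snd v - 1) div 3 = snd v div 3" by blast+
          then show False using False by (simp add: low_def up_def)
        qed
        then show ?thesis using False by (auto simp: B_def)
      qed
      finally show ?thesis .
    qed
  qed
  then obtain B' where "normal_labelling H B'"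
    using normal_labelling_iso[OF H iso] by blast
  then show ?thesis
    using spectral_radius_le_if_normal_labelling[OF H _ ne] by simp
qed

section \<open>Pendant paths grown from small labels\<close>

abbreviation piece :: "(nat \<Rightarrow> 'a) \<Rightarrow> nat \<Rightarrow> 'a set" where
  "piece f t \<equiv> f ` {3 * t..3 * t + 3}"

text \<open>The vertex \<open>f 0\<close> is the attaching vertex, and the edges through it are left unspecified.
  In each edge the vertex nearest to the attaching vertex is the only one with a label below
  \<open>1 / 2\<close>; this orients the edges and excludes cycles.\<close>

definition branch :: "'a hypergraph \<Rightarrow> ('a \<Rightarrow> 'a set \<Rightarrow> real) \<Rightarrow> nat \<Rightarrow> (nat \<Rightarrow> 'a) \<Rightarrow> bool" where
  "branch H B l f \<longleftrightarrow>
     (\<forall>t<l. piece f t \<in> edges H \<and> B (f (3 * t)) (piece f t) < 1 / 2 \<and>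
        (\<forall>n. 3 * t < n \<and> n \<le> 3 * t + 3 \<longrightarrow> 1 / 2 < B (f n) (piece f t))) \<and>
     (\<forall>n. 0 < n \<and> n \<le> 3 * l \<longrightarrow>
        {e \<in> edges H. f n \<in> e} = {piece f t |t. t < l \<and> 3 * t \<le> n \<and> n \<le> 3 * t + 3})"

locale labelled_4_graph =
  fixes H :: "'a hypergraph" and B :: "'a \<Rightarrow> 'a set \<Rightarrow> real"
  assumes uniform: "uniform_hypergraph 4 H" and labelling: "normal_labelling H B"
begin

lemmas H' = uniform_hypergraphD[OF uniform]
lemmas B' = normal_labellingD[OF labelling]
lemmas label_bounds = normal_label_bounds[OF uniform labelling]

text \<open>Dropping factors that are at most 1 does not decrease the product.\<close>

lemma prod_subset_ge:
  assumes e: "e \<in> edges H" and S: "S \<subseteq> e"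
  shows "1 / 4 \<le> (\<Prod>v\<in>S. B v e)"
proof -
  have "1 / 4 \<le> (\<Prod>v\<in>e - S. B v e) * (\<Prod>v\<in>S. B v e)"
    using B'(4)[OF e] prod.subset_diff[OF S H'(5)[OF e], of "\<lambda>v. B v e"] by simp
  also have "\<dots> \<le> 1 * (\<Prod>v\<in>S. B v e)"
  proof (intro mult_right_mono prod_le_1 prod_nonneg)
    show "0 \<le> B v e \<and> B v e \<le> 1" if "v \<in> e - S" for v
      using that B'(2) label_bounds(1) e by blast
    show "0 \<le> B v e" if "v \<in> S" for v
      using that B'(2) e S by blast
  qed
  finally show ?thesis by simp
qed

lemma sum_labels_le:
  assumes "finite G" "\<And>g. g \<in> G \<Longrightarrow> g \<in> edges H \<and> v \<in> g"
  shows "(\<Sum>g\<in>G. B v g) \<le> 1"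
proof (cases "G = {}")
  case False
  then have "v \<in> verts H" using assms H'(3) by blast
  then show ?thesis using sum_normal_labels_le[OF uniform labelling] assms by blast
qed simp

lemma labels2_le:
  assumes "e \<in> edges H" "g \<in> edges H" "v \<in> e" "v \<in> g" "e \<noteq> g"
  shows "B v e + B v g \<le> 1"
  using sum_labels_le[of "{e, g}" v] assms by auto

lemma edge_eq_if_labels_gt_half:
  assumes "e \<in> edges H" "g \<in> edges H" "v \<in> e" "v \<in> g" "1 / 2 < B v e" "1 / 2 < B v g"
  shows "e = g"
  using labels2_le[of e g v] assms by force

lemma non_leaf_edge:
  assumes "e \<in> edges H" "v \<in> e" "\<not> leaf_vertex H v"
  obtains g where "g \<in> edges H" "v \<in> g" "g \<noteq> e"
proof -
  have "v \<in> verts H" using assms H'(3) by blast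
  then show ?thesis using assms that unfolding leaf_vertex_def by metis
qed

lemma non_leaf_label_le:
  assumes "e \<in> edges H" "v \<in> e" "\<not> leaf_vertex H v"
  shows "B v e \<le> 3 / 4"
proof -
  obtain g where g: "g \<in> edges H" "v \<in> g" "g \<noteq> e" using non_leaf_edge assms by blast
  then show ?thesis using labels2_le[of e g v] label_bounds(2)[of g v] assms by simp
qed

lemma leaf_incidence:
  assumes "e \<in> edges H" "v \<in> e" "leaf_vertex H v"
  shows "{g \<in> edges H. v \<in> g} = {e}"
  using assms unfolding leaf_vertex_def by blast

text \<open>A third edge at \<open>v\<close> would bring the label sum above 1/2 + 1/4 + 1/4 =
  1.\<close>

lemma two_edges_incidence:
  assumes e: "e \<in> edges H" "v \<in> e" and g: "g \<in> edges H" "v \<in> g" "g \<noteq> e" and gt: "1 / 2 < B v e"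
  shows "{e \<in> edges H. v \<in> e} = {e, g}"
proof -
  have "h = e \<or> h = g" if h: "h \<in> edges H" "v \<in> h" for h
  proof (rule ccontr)
    assume no: "\<not> ?thesis"
    have "(\<Sum>f\<in>{e, g, h}. B v f) \<le> 1"
      by (rule sum_labels_le) (use e g h in auto)
    moreover have "(\<Sum>f\<in>{e, g, h}. B v f) = B v e + (B v g + B v h)"
    proof -
      have "e \<noteq> g" "e \<noteq> h" "g \<noteq> h" using no g(3) by metis+
      then show ?thesis by simp
    qed
    ultimately show False using label_bounds(2)[OF g(1,2)] label_bounds(2)[OF h] gt by simp
  qed
  then show ?thesis using e g by auto
qed

text \<open>Induction on a bound \<open>m\<close> for the length. The recurrence
  \<open>path_label_Suc\<close> is used twice: downwards, a label below
  \<open>path_label (Suc (Suc m))\<close> forces a label below \<open>path_label (Suc m)\<close> in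
  the next edge; upwards, the lower bound \<open>path_label l\<close> for the next edge becomes
  \<open>path_label (Suc l)\<close> here.\<close>

lemma branch_exists:
  assumes "B v e < path_label (Suc m)" "m \<le> 7" "e \<in> edges H" "v \<in> e"
  shows "\<exists>l f. 1 \<le> l \<and> branch H B l f \<and> f 0 = v \<and> piece f 0 = e \<and> path_label l \<le> B v e"
  using assms
proof (induction m arbitrary: v e)
  case 0
  \<comment> \<open>Since \<open>path_label 1 = 1 / 4\<close> is a lower bound for all labels, this
    case is void.\<close>
  then show ?case using label_bounds(2)[of e v] by (simp add: path_label_def)
next
  case (Suc m)
  note e = Suc.prems(3,4)
  \<comment> \<open>The value \<open>path_label 8 = 4 / 9\<close> explains \<open>m \<le> 7\<close>:
    below 4/9, all other labels in \<open>e\<close> exceed 9/16, and two further non-leaf vertices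
    would give a product below 4/9 * (3/4)^2 = 1/4.\<close>
  have "B v e < path_label 8"
    using Suc.prems(1,2) path_label_mono[of "Suc (Suc m)" 8] by linarith
  then have small: "B v e < 4 / 9" by (simp add: path_label_def)
  have pos: "0 < B v e" using B'(1) e by blast
  have pair: "1 / 4 \<le> B v e * B u e" if "u \<in> e" "u \<noteq> v" for u
    using prod_subset_ge[OF e(1), of "{v, u}"] that e by auto
  have high: "9 / 16 < B u e" if u: "u \<in> e" "u \<noteq> v" for u
  proof -
    have "B v e * B u e < 4 / 9 * B u e" using small B'(1)[OF e(1) u(1)] by simp
    then show ?thesis using pair[OF u] by simp
  qed
  have fine: "finite e" "card e = 4" using H' e by auto
  have card3: "card (e - {v}) = 3" using fine e by simp
  show ?case
  proof (cases "\<exists>w\<in>e - {v}. \<not> leaf_vertex H w")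
    case False
    \<comment> \<open>Here the path ends with \<open>e\<close>, whose three leaves may be listed in
      any order.\<close>
    obtain a b c where abc: "e - {v} = {a, b, c}"
      using card3 by (auto simp: card_3_iff)
    define f where "f n = [v, a, b, c] ! n" for n
    have piece: "piece f 0 = e"
    proof -
      have "{3 * 0..3 * 0 + 3} = {0, 1, 2, 3 :: nat}" by auto
      then have "piece f 0 = {v, a, b, c}" by (simp add: f_def)
      also have "\<dots> = e" using abc e by blast
      finally show ?thesis .
    qed
    have f: "f n \<in> e - {v}" if "0 < n" "n \<le> 3" for n
    proof -
      have "n = 1 \<or> n = 2 \<or> n = 3" using that by auto
      then show ?thesis unfolding abc by (auto simp: f_def)
    qed
    have "branch H B 1 f"
      unfolding branch_def
    proof (intro conjI allI impI)
      fix n :: nat assume n: "0 < n \<and> n \<le> 3 * 1"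
      then have "leaf_vertex H (f n)" "f n \<in> e" using f[of n] False by auto
      then have "{e \<in> edges H. f n \<in> e} = {e}" using leaf_incidence[OF e(1)] by blast
      also have "\<dots> = {piece f t |t. t < 1 \<and> 3 * t \<le> n \<and> n \<le> 3 * t + 3}"
        using n piece by auto
      finally show "{e \<in> edges H. f n \<in> e}
          = {piece f t |t. t < 1 \<and> 3 * t \<le> n \<and> n \<le> 3 * t + 3}" .
    next
      fix t :: nat assume t: "t < 1"
      then show "piece f t \<in> edges H" using piece e by simp
      have "B (f 0) e < 1 / 2" using small by (simp add: f_def)
      then show "B (f (3 * t)) (piece f t) < 1 / 2" using t piece by simp
      fix n assume "3 * t < n \<and> n \<le> 3 * t + 3"
      then have "1 / 2 < B (f n) e" using high[of "f n"] f[of n] t by auto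
      then show "1 / 2 < B (f n) (piece f t)" using t piece by simp
    qed
    moreover have "path_label 1 \<le> B v e"
      using label_bounds(2)[OF e] by (simp add: path_label_def)
    moreover have "f 0 = v" by (simp add: f_def)
    ultimately show ?thesis using piece by (intro exI[of _ 1] exI[of _ f]) simp
  next
    case True
    then obtain w where w: "w \<in> e" "w \<noteq> v" "\<not> leaf_vertex H w" by blast
    obtain g where g: "g \<in> edges H" "w \<in> g" "g \<noteq> e" using non_leaf_edge[OF e(1) w(1,3)] by blast
    have leaves: "leaf_vertex H u" if u: "u \<in> e" "u \<noteq> v" "u \<noteq> w" for u
    proof (rule ccontr)
      assume "\<not> leaf_vertex H u"
      then have "B u e \<le> 3 / 4" "B w e \<le> 3 / 4"
        using non_leaf_label_le[OF e(1)] u w by blast+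
      moreover have "0 \<le> B u e" "0 \<le> B w e" using B'(2)[OF e(1)] u w by blast+
      ultimately have "B u e * B w e \<le> 3 / 4 * (3 / 4)" by (intro mult_mono) auto
      then have "B v e * (B u e * B w e) \<le> B v e * (9 / 16)" using pos by simp
      moreover have "1 / 4 \<le> B v e * (B u e * B w e)"
        using prod_subset_ge[OF e(1), of "{v, u, w}"] u w e by auto
      ultimately show False using small by simp
    qed
    have "card (e - {v} - {w}) = 2" using card3 fine w by simp
    then obtain a b where ab: "e - {v} - {w} = {a, b}" by (auto simp: card_2_iff)
    have inc_w: "{e \<in> edges H. w \<in> e} = {e, g}"
      using two_edges_incidence[OF e(1) w(1) g] high[OF w(1,2)] by simp
    have sum: "B w e + B w g \<le> 1" using labels2_le[of e g w] e w g by blast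
    have step: "path_label (Suc k) * (1 - path_label k) \<le> B v e * B w e" for k
      using pair[OF w(1,2)] by (simp add: path_label_Suc)
    have "1 - path_label (Suc m) < B w e"
    proof (rule ccontr)
      assume "\<not> ?thesis"
      then have "B v e * B w e \<le> B v e * (1 - path_label (Suc m))" using pos by simp
      also have "\<dots> < path_label (Suc (Suc m)) * (1 - path_label (Suc m))"
        using Suc.prems(1) path_label_bounds(3)[of "Suc m"] by (intro mult_strict_right_mono) auto
      finally show False using step[of "Suc m"] by simp
    qed
    then have "B w g < path_label (Suc m)" using sum by simp
    then obtain l f where l: "1 \<le> l" and f: "branch H B l f" "f 0 = w" "piece f 0 = g"
        and lab: "path_label l \<le> B w g"
      using Suc.IH[of w g] Suc.prems(2) g by auto
    \<comment> \<open>Prepend \<open>e\<close> to the path \<open>f\<close>: positions 0, 1, 2 are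
      \<open>v\<close>, \<open>a\<close>, \<open>b\<close>, and position 3 is the shared vertex
      \<open>f 0 = w\<close>.\<close>
    define h where "h n = (if n < 3 then [v, a, b] ! n else f (n - 3))" for n
    have h_shift: "h (n + 3) = f n" for n by (simp add: h_def)
    have piece0: "piece h 0 = e"
    proof -
      have "{3 * 0..3 * 0 + 3} = {0, 1, 2, 3 :: nat}" by auto
      then have "piece h 0 = {v, a, b, w}" using f(2) by (auto simp: h_def)
      also have "\<dots> = e" using ab e w by blast
      finally show ?thesis .
    qed
    have pieceS: "piece h (Suc t) = piece f t" for t
    proof -
      have "{3 * Suc t..3 * Suc t + 3} = (\<lambda>n. n + 3) ` {3 * t..3 * t + 3}"
        by (simp add: add.commute)
      then show ?thesis by (simp only: image_image h_shift)
    qed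
    have h: "h n \<in> e \<and> h n \<noteq> v" "n < 3 \<Longrightarrow> h n \<noteq> w" if "0 < n" "n \<le> 3" for n
    proof -
      have n: "n = 1 \<or> n = 2 \<or> n = 3" using that by auto
      have "a \<in> e - {v} - {w}" "b \<in> e - {v} - {w}" unfolding ab by auto
      then show "h n \<in> e \<and> h n \<noteq> v" "n < 3 \<Longrightarrow> h n \<noteq> w"
        using n w f(2) by (auto simp: h_def)
    qed
    have "branch H B (Suc l) h"
      unfolding branch_def
    proof (intro conjI allI impI)
      fix t assume t: "t < Suc l"
      show "piece h t \<in> edges H"
        using t piece0 pieceS e f(1) by (cases t) (auto simp: branch_def)
      show "B (h (3 * t)) (piece h t) < 1 / 2"
      proof (cases t)
        case 0
        have "B (h 0) e < 1 / 2" using small by (simp add: h_def)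
        then show ?thesis using 0 piece0 by simp
      next
        case (Suc s)
        have "h (3 * t) = f (3 * s)" using h_shift[of "3 * s"] Suc by (simp add: add.commute)
        then show ?thesis using f(1) t Suc pieceS by (simp add: branch_def)
      qed
      fix n assume n: "3 * t < n \<and> n \<le> 3 * t + 3"
      show "1 / 2 < B (h n) (piece h t)"
      proof (cases t)
        case 0
        have "1 / 2 < B (h n) e" using high[of "h n"] h(1)[of n] n 0 by auto
        then show ?thesis using 0 piece0 by simp
      next
        case (Suc s)
        have "h n = f (n - 3)" using h_shift[of "n - 3"] Suc n by simp
        moreover have "3 * s < n - 3 \<and> n - 3 \<le> 3 * s + 3" "s < l" using n t Suc by auto
        ultimately show ?thesis using f(1) Suc pieceS by (simp add: branch_def)
      qed
    next
      fix n assume n: "0 < n \<and> n \<le> 3 * Suc l"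
      define R where "R = {piece h t |t. t < Suc l \<and> 3 * t \<le> n \<and> n \<le> 3 * t + 3}"
      have R: "R = (if n \<le> 3 then {e} else {}) \<union>
          {piece f t |t. t < l \<and> 3 * t + 3 \<le> n \<and> n \<le> 3 * t + 6}" (is "_ = ?R1 \<union> ?R2")
      proof (intro subset_antisym subsetI)
        fix x assume "x \<in> R"
        then obtain t where t: "x = piece h t" "t < Suc l" "3 * t \<le> n" "n \<le> 3 * t + 3"
          by (auto simp: R_def)
        show "x \<in> ?R1 \<union> ?R2"
        proof (cases t)
          case 0
          then show ?thesis using t piece0 by simp
        next
          case (Suc s)
          then have "x = piece f s" "s < l" "3 * s + 3 \<le> n" "n \<le> 3 * s + 6"
            using t pieceS by auto
          then show ?thesis by blast
        qed
      next
        fix x assume "x \<in> ?R1 \<union> ?R2"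
        then consider "n \<le> 3" "x = e"
          | t where "x = piece f t" "t < l" "3 * t + 3 \<le> n" "n \<le> 3 * t + 6"
          by (auto split: if_splits)
        then show "x \<in> R"
        proof cases
          case 1
          then have "x = piece h 0 \<and> 0 < Suc l \<and> 3 * 0 \<le> n \<and> n \<le> 3 * 0 + 3"
            using piece0 by simp
          then show ?thesis unfolding R_def by blast
        next
          case 2
          then have "x = piece h (Suc t) \<and> Suc t < Suc l \<and> 3 * Suc t \<le> n \<and> n \<le> 3 * Suc t + 3"
            using pieceS by simp
          then show ?thesis unfolding R_def by blast
        qed
      qed
      have "{e \<in> edges H. h n \<in> e} = R"
      proof -
        consider "n < 3" | "n = 3" | "3 < n" by linarith
        then show ?thesis
        proof cases
          case 1
          then have "leaf_vertex H (h n)" "h n \<in> e" using h[of n] n leaves by auto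
          then show ?thesis using leaf_incidence[OF e(1)] 1 by (auto simp: R)
        next
          case 2
          \<comment> \<open>Position 3 is the attaching vertex of \<open>f\<close>, whose edges
            \<open>branch H B l f\<close> leaves open; \<open>inc_w\<close> supplies them.\<close>
          have "h n = w" using 2 f(2) by (simp add: h_def)
          moreover have "?R2 = {g}"
          proof -
            have "(t < l \<and> 3 * t + 3 \<le> n \<and> n \<le> 3 * t + 6) \<longleftrightarrow> t = 0" for t
              using 2 l by auto
            then show ?thesis using f(3) by simp
          qed
          ultimately show ?thesis using inc_w 2 by (simp add: R insert_commute)
        next
          case 3
          have "h n = f (n - 3)" using h_shift[of "n - 3"] 3 by simp
          moreover have "{e \<in> edges H. f (n - 3) \<in> e}
              = {piece f t |t. t < l \<and> 3 * t \<le> n - 3 \<and> n - 3 \<le> 3 * t + 3}"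
            using f(1) n 3 unfolding branch_def by auto
          moreover have "3 * t \<le> n - 3 \<and> n - 3 \<le> 3 * t + 3 \<longleftrightarrow> 3 * t + 3 \<le> n \<and> n \<le> 3 * t + 6" for t
            using 3 by auto
          ultimately show ?thesis using 3 by (simp add: R)
        qed
      qed
      then show "{e \<in> edges H. h n \<in> e}
          = {piece h t |t. t < Suc l \<and> 3 * t \<le> n \<and> n \<le> 3 * t + 3}"
        unfolding R_def .
    qed
    moreover have "path_label (Suc l) \<le> B v e"
    proof (rule ccontr)
      assume no: "\<not> ?thesis"
      have "B v e * B w e \<le> B v e * (1 - path_label l)" using pos sum lab by simp
      also have "\<dots> < path_label (Suc l) * (1 - path_label l)"
        using no path_label_bounds(3)[of l] by (intro mult_strict_right_mono) auto
      finally show False using step[of l] by simp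
    qed
    moreover have "h 0 = v" by (simp add: h_def)
    ultimately show ?thesis using piece0 by (intro exI[of _ "Suc l"] exI[of _ h]) simp
  qed
qed

end

section \<open>Classification of irreducible 4-uniform hypergraphs\<close>

context labelled_4_graph
begin

text \<open>The other three labels are at most 3/4, so \<open>B u F\<close> is at least (1/4) /
  (27/64) = 16/27. At most 11/27 is left for the second edge at \<open>u\<close>, which is below
  \<open>path_label 5 = 5 / 12\<close>, so \<open>branch_exists\<close> applies with
  \<open>m = 4\<close>.\<close>

lemma irreducible_edge_branch:
  assumes F: "F \<in> edges H" and nl: "\<And>v. v \<in> F \<Longrightarrow> \<not> leaf_vertex H v" and u: "u \<in> F"
  shows "1 / 2 < B u F \<and> (\<exists>l f. 1 \<le> l \<and> branch H B l f \<and> f 0 = u \<and> piece f 0 \<noteq> F \<and>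
    {e \<in> edges H. u \<in> e} = {F, piece f 0} \<and> B u F \<le> 1 - path_label l)"
proof -
  have "(\<Prod>v\<in>F - {u}. B v F) \<le> (\<Prod>v\<in>F - {u}. 3 / 4)"
    using B'(2)[OF F] non_leaf_label_le[OF F] nl by (intro prod_mono) blast
  also have "\<dots> = 27 / 64" using H'(4,5)[OF F] u by (simp add: power3_eq_cube)
  finally have "B u F * (\<Prod>v\<in>F - {u}. B v F) \<le> B u F * (27 / 64)"
    using B'(2)[OF F u] by (intro mult_left_mono)
  moreover have "1 / 4 \<le> B u F * (\<Prod>v\<in>F - {u}. B v F)"
    using B'(4)[OF F] H'(5)[OF F] u by (simp add: prod.remove[of F u])
  ultimately have high: "16 / 27 \<le> B u F" by simp
  obtain g where g: "g \<in> edges H" "u \<in> g" "g \<noteq> F" using non_leaf_edge[OF F u nl[OF u]] by blast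
  have sum: "B u F + B u g \<le> 1" using labels2_le[of F g u] F u g by blast
  have "path_label (Suc 4) = 5 / 12" by (simp add: path_label_def)
  then have "B u g < path_label (Suc 4)" using high sum by simp
  then obtain l f where "1 \<le> l" "branch H B l f" "f 0 = u" "piece f 0 = g" "path_label l \<le> B u g"
    using branch_exists[of u g 4] g by auto
  moreover have "{e \<in> edges H. u \<in> e} = {F, g}"
    using two_edges_incidence[OF F u g] high by simp
  ultimately show ?thesis using g(3) high sum by (intro conjI exI[of _ l] exI[of _ f]) auto
qed

end

text \<open>Serves maps built from the model \<open>K\<close> to \<open>H\<close>, against the
  direction in \<open>hypergraph_iso\<close>.\<close>

lemma hypergraph_iso_if_bij_betw:
  assumes bij: "bij_betw f (verts K) (verts H)" and E: "image f ` edges K = edges H"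
    and sub: "\<And>e. e \<in> edges K \<Longrightarrow> e \<subseteq> verts K"
  shows "hypergraph_iso H K"
proof -
  let ?g = "inv_into (verts K) f"
  have inj: "inj_on f (verts K)" using bij by (simp add: bij_betw_def)
  have "?g ` (f ` e) = e" if "e \<in> edges K" for e
    using inv_into_image_cancel[OF inj sub[OF that]] .
  then have "image ?g ` edges H = edges K"
    unfolding E[symmetric] image_image by simp
  then show ?thesis using bij_betw_inv_into[OF bij] by (auto simp: hypergraph_iso_def)
qed

text \<open>Three factors are at most 3/4, so \<open>path_label l\<close> is at most 1 - 16/27 =
  11/27 and \<open>l \<le> 4\<close>. The finitely many remaining quadruples are evaluated.\<close>

lemma path_label_cases:
  assumes "1 \<le> i" "i \<le> j" "j \<le> k" "k \<le> l"
    and prod: "1 / 4 \<le> (1 - path_label i) * (1 - path_label j) * (1 - path_label k) * (1 - path_label l)"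
  shows "(i, j, k, l) \<in> {(1,1,2,2), (1,1,1,1), (1,1,1,2), (1,1,1,3), (1,1,1,4)}"
proof -
  have le: "1 - path_label n \<le> 3 / 4" "0 \<le> 1 - path_label n" if "1 \<le> n" for n
  proof -
    have "path_label 1 = 1 / 4" by (simp add: path_label_def)
    then show "1 - path_label n \<le> 3 / 4" "0 \<le> 1 - path_label n"
      using path_label_mono[OF that] path_label_bounds(3)[of n] by linarith+
  qed
  have "(1 - path_label i) * (1 - path_label j) * (1 - path_label k) * (1 - path_label l)
      \<le> 3 / 4 * (3 / 4) * (3 / 4) * (1 - path_label l)"
    using assms by (intro mult_mono le mult_nonneg_nonneg) auto
  with prod have "path_label l \<le> 11 / 27" by simp
  then have "l \<le> 4" by (simp add: path_label_def field_simps)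
  then have "i \<in> {1, 2, 3, 4}" "j \<in> {1, 2, 3, 4}" "k \<in> {1, 2, 3, 4}" "l \<in> {1, 2, 3, 4}"
    using assms(1-4) by auto
  then show ?thesis
    using assms by (elim insertE emptyE) (simp_all add: path_label_def)
qed

context labelled_4_graph
begin

text \<open>The branches at the four vertices of \<open>F\<close> give a map \<open>\<phi>\<close>
  from \<open>H4 i j k l\<close> to \<open>H\<close>. It is onto because no edge crosses the
  boundary of its image, and injective because the labels orient the edges.\<close>

lemma irreducible_iso_H4:
  assumes cr: "crossing H"
    and F: "F \<in> edges H" and nl: "\<And>v. v \<in> F \<Longrightarrow> \<not> leaf_vertex H v"
  shows "\<exists>i j k l. (i, j, k, l) \<in> {(1,1,2,2), (1,1,1,1), (1,1,1,2), (1,1,1,3), (1,1,1,4)} \<and>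
    hypergraph_iso H (H4 i j k l)"
proof -
  have highF: "1 / 2 < B u F" if "u \<in> F" for u
    using irreducible_edge_branch[OF F nl that] by blast
  define Q where "Q u lf \<longleftrightarrow> (case lf of (l, f) \<Rightarrow> 1 \<le> l \<and> branch H B l f \<and> f 0 = u \<and> piece f 0 \<noteq> F \<and>
      {e \<in> edges H. u \<in> e} = {F, piece f 0} \<and> B u F \<le> 1 - path_label l)" for u lf
  have "\<forall>u\<in>F. \<exists>lf. Q u lf"
  proof
    fix u assume "u \<in> F"
    then obtain l f where "1 \<le> l \<and> branch H B l f \<and> f 0 = u \<and> piece f 0 \<noteq> F \<and>
        {e \<in> edges H. u \<in> e} = {F, piece f 0} \<and> B u F \<le> 1 - path_label l"
      using irreducible_edge_branch[OF F nl] by meson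
    then have "Q u (l, f)" by (simp add: Q_def)
    then show "\<exists>lf. Q u lf" ..
  qed
  then obtain LG where LG: "\<forall>u\<in>F. Q u (LG u)" using bchoice by blast
  define L where "L u = fst (LG u)" for u
  define G where "G u = snd (LG u)" for u
  have LG: "1 \<le> L u" "branch H B (L u) (G u)" "G u 0 = u"
      "{e \<in> edges H. u \<in> e} = {F, piece (G u) 0}" "B u F \<le> 1 - path_label (L u)"
    if "u \<in> F" for u
    using LG[rule_format, OF that] by (simp_all add: Q_def L_def G_def split_beta)
  have fF: "finite F" "card F = 4" using H' F by auto
  obtain ys where ys: "set ys = F" "distinct ys" using finite_distinct_list[OF fF(1)] by blast
  \<comment> \<open>Sorting the vertices of \<open>F\<close> by branch length puts the lengths in
    the order that \<open>path_label_cases\<close> assumes.\<close>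
  define xs where "xs = sort_key L ys"
  have xs: "set xs = F" "distinct xs" "sorted (map L xs)"
    using ys by (simp_all add: xs_def)
  have len: "length xs = 4" using xs fF distinct_card[of xs] by simp
  define i j k l where "i = L (xs ! 0)" "j = L (xs ! 1)" "k = L (xs ! 2)" "l = L (xs ! 3)"
  note ijkl = i_j_k_l_def
  let ?K = "H4 i j k l"
  have xF: "xs ! p \<in> F" if "p < 4" for p using that len xs(1) nth_mem by metis
  have L: "[i, j, k, l] ! p = L (xs ! p)" if "p < 4" for p
    using that by (auto simp: ijkl less_4_iff)
  have pos: "1 \<le> i" "1 \<le> j" "1 \<le> k" "1 \<le> l" using xF LG(1) by (simp_all add: ijkl)
  have ord: "i \<le> j" "j \<le> k" "k \<le> l"
    using xs(3) len by (auto simp: ijkl sorted_iff_nth_mono)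
  have xs4: "xs = [xs ! 0, xs ! 1, xs ! 2, xs ! 3]"
    using len by (intro nth_equalityI) (auto simp: less_4_iff)
  have F4: "F = {xs ! 0, xs ! 1, xs ! 2, xs ! 3}" using xs(1) xs4 by (metis list.simps(15) set_empty2)
  have "1 / 4 \<le> (\<Prod>u\<in>F. B u F)" using B'(4)[OF F] .
  also have "\<dots> \<le> (\<Prod>u\<in>F. 1 - path_label (L u))"
    using LG(5) B'(2)[OF F] by (intro prod_mono) blast
  also have "\<dots> = prod_list (map (\<lambda>u. 1 - path_label (L u)) xs)"
    using prod.distinct_set_conv_list[OF xs(2)] xs(1) by metis
  also have "\<dots> = (1 - path_label i) * (1 - path_label j) * (1 - path_label k) * (1 - path_label l)"
    by (subst xs4) (simp add: ijkl)
  finally have cases: "(i, j, k, l) \<in> {(1,1,2,2), (1,1,1,1), (1,1,1,2), (1,1,1,3), (1,1,1,4)}"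
    by (rule path_label_cases[OF pos(1) ord])
  define \<phi> where "\<phi> v = G (xs ! fst v) (snd v)" for v :: "nat \<times> nat"
  have K: "verts ?K = {(p, n). p < 4 \<and> n \<le> 3 * L (xs ! p)}"
    "edges ?K = insert H4_centre {H4_edge p t |p t. p < 4 \<and> t < L (xs ! p)}"
    using L by (auto simp: verts_H4 edges_H4)
  have \<phi>0: "\<phi> (p, 0) = xs ! p" if "p < 4" for p using LG(3) xF[OF that] by (simp add: \<phi>_def)
  have \<phi>_centre: "\<phi> ` H4_centre = F"
    unfolding H4_centre_def using \<phi>0 F4 by simp
  have \<phi>_edge: "\<phi> ` H4_edge p t = piece (G (xs ! p)) t" for p t
  proof -
    have "H4_edge p t = Pair p ` {3 * t..3 * t + 3}" by (auto simp: H4_edge_def)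
    then show ?thesis by (simp add: image_image \<phi>_def)
  qed
  have br: "piece (G (xs ! p)) t \<in> edges H" "B (\<phi> (p, 3 * t)) (piece (G (xs ! p)) t) < 1 / 2"
      "\<And>n. 3 * t < n \<Longrightarrow> n \<le> 3 * t + 3 \<Longrightarrow> 1 / 2 < B (\<phi> (p, n)) (piece (G (xs ! p)) t)"
    if "p < 4" "t < L (xs ! p)" for p t
    using LG(2)[OF xF[OF that(1)]] that(2) by (simp_all add: branch_def \<phi>_def)
  have mem: "\<phi> (p, n) \<in> piece (G (xs ! p)) t" if "3 * t \<le> n" "n \<le> 3 * t + 3" for p t n
    using that by (simp add: \<phi>_def)
  have pieceK: "piece (G (xs ! p)) t \<in> image \<phi> ` edges ?K" if "p < 4" "t < L (xs ! p)" for p t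
    unfolding \<phi>_edge[symmetric] K using that by blast
  have FK: "F \<in> image \<phi> ` edges ?K" using \<phi>_centre K by blast
  have into_E: "image \<phi> ` edges ?K \<subseteq> edges H"
    using br(1) F \<phi>_edge \<phi>_centre unfolding K by auto
  \<comment> \<open>Every edge of \<open>H\<close> that meets the image is itself an image: at
    position 0 it is \<open>F\<close> or the first piece, elsewhere the incidence clause of
    \<open>branch\<close> lists it.\<close>
  have incident: "e \<in> image \<phi> ` edges ?K" if v: "v \<in> verts ?K" and e: "e \<in> edges H" "\<phi> v \<in> e" for v e
  proof -
    obtain p n where pn: "v = (p, n)" "p < 4" "n \<le> 3 * L (xs ! p)" using v K by auto
    note LG' = LG[OF xF[OF pn(2)]]
    show ?thesis
    proof (cases "n = 0")
      case True
      then have "xs ! p \<in> e" using e(2) \<phi>0[OF pn(2)] pn(1) by simp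
      then have "e \<in> {F, piece (G (xs ! p)) 0}"
        unfolding LG'(4)[symmetric] using e(1) by simp
      then show ?thesis using FK pieceK[OF pn(2), of 0] LG'(1) by auto
    next
      case False
      then have "{e \<in> edges H. G (xs ! p) n \<in> e}
          = {piece (G (xs ! p)) t |t. t < L (xs ! p) \<and> 3 * t \<le> n \<and> n \<le> 3 * t + 3}"
        using LG'(2) pn(3) by (simp add: branch_def)
      moreover have "G (xs ! p) n \<in> e" using e pn by (simp add: \<phi>_def)
      ultimately have "e \<in> {piece (G (xs ! p)) t |t. t < L (xs ! p) \<and> 3 * t \<le> n \<and> n \<le> 3 * t + 3}"
        using e(1) by blast
      then show ?thesis using pieceK[OF pn(2)] by blast
    qed
  qed
  have KE: "e \<subseteq> verts ?K" if "e \<in> edges ?K" for e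
    using uniform_hypergraphD(3)[OF H4_pendant_paths(1)[OF pos] that] .
  have K_union: "verts ?K = \<Union> (edges ?K)" using H4_pendant_paths(2)[OF pos] .
  have img: "\<phi> ` verts ?K = verts H"
  proof (rule ccontr)
    assume ne: "\<phi> ` verts ?K \<noteq> verts H"
    have "\<phi> ` verts ?K \<subseteq> verts H"
      unfolding K_union using into_E H'(3) by blast
    moreover have "(0, 0) \<in> verts ?K" by (simp add: K(1))
    then have "\<phi> ` verts ?K \<noteq> {}" by blast
    ultimately obtain e where e: "e \<in> edges H" "e \<inter> \<phi> ` verts ?K \<noteq> {}" "e - \<phi> ` verts ?K \<noteq> {}"
      using cr ne unfolding crossing_def by meson
    then obtain v where "v \<in> verts ?K" "\<phi> v \<in> e" by blast
    then obtain d where "d \<in> edges ?K" "e = \<phi> ` d" using incident e(1) by blast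
    then have "e \<subseteq> \<phi> ` verts ?K" using KE by blast
    then show False using e(3) by blast
  qed
  have E: "image \<phi> ` edges ?K = edges H"
  proof (rule subset_antisym[OF into_E subsetI])
    fix e assume e: "e \<in> edges H"
    then have "e \<noteq> {}" using H'(4)[OF e] by auto
    then obtain w where w: "w \<in> e" by blast
    then have "w \<in> \<phi> ` verts ?K" using H'(3)[OF e] unfolding img by blast
    then obtain v where "v \<in> verts ?K" "\<phi> v \<in> e" using w by blast
    then show "e \<in> image \<phi> ` edges ?K" using incident e by blast
  qed
  \<comment> \<open>Each piece contains a label below 1/2, whereas all labels in \<open>F\<close>
    exceed 1/2.\<close>
  have piece_neq_F: "piece (G (xs ! p)) t \<noteq> F" if "p < 4" "t < L (xs ! p)" for p t
  proof
    assume "piece (G (xs ! p)) t = F"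
    then have "B (\<phi> (p, 3 * t)) F < 1 / 2" "\<phi> (p, 3 * t) \<in> F"
      using br(2)[OF that] mem[of t "3 * t" p] by auto
    then show False using highF by force
  qed
  text \<open>A vertex determines the edge in which its label exceeds \<open>1 / 2\<close>, and an edge other than
    \<open>F\<close> determines its vertex with label below \<open>1 / 2\<close>. Hence two positions with the same image
    have the same predecessors back to \<open>F\<close>.\<close>
  have parent: "\<exists>t<L (xs ! p). 3 * t < n \<and> n \<le> 3 * t + 3" if "0 < n" "n \<le> 3 * L (xs ! p)" for p n
    using that by (intro exI[of _ "(n - 1) div 3"]) auto
  have inj0: "n = 0" if p: "p < 4" and q: "q < 4" "n \<le> 3 * L (xs ! q)" and eq: "\<phi> (p, 0) = \<phi> (q, n)" for p q n
  proof (rule ccontr)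
    assume "n \<noteq> 0"
    then obtain t where t: "t < L (xs ! q)" "3 * t < n" "n \<le> 3 * t + 3"
      using parent[of n q] q by auto
    have "\<phi> (q, n) \<in> F" "1 / 2 < B (\<phi> (q, n)) F"
      using highF[OF xF[OF p]] xF[OF p] \<phi>0[OF p] eq by simp_all
    then have "piece (G (xs ! q)) t = F"
      using edge_eq_if_labels_gt_half[OF br(1)[OF q(1) t(1)] F] br(3)[OF q(1) t] mem[of t n q] t
      by auto
    then show False using piece_neq_F q(1) t(1) by blast
  qed
  have inj: "p = q \<and> n = m"
    if "p < 4" "n \<le> 3 * L (xs ! p)" "q < 4" "m \<le> 3 * L (xs ! q)" "\<phi> (p, n) = \<phi> (q, m)" for p q n m
    using that
  proof (induction n arbitrary: p q m rule: less_induct)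
    case (less n)
    note p = less.prems(1,2) and q = less.prems(3,4) and eq = less.prems(5)
    show ?case
    proof (cases "n = 0 \<or> m = 0")
      case True
      then have 0: "n = 0" "m = 0"
        using inj0[OF p(1) q] inj0[OF q(1) p] eq by auto
      then have "xs ! p = xs ! q" using eq \<phi>0 p(1) q(1) by simp
      then show ?thesis using 0 xs(2) p(1) q(1) len by (simp add: nth_eq_iff_index_eq)
    next
      case False
      then obtain s t where s: "s < L (xs ! p)" "3 * s < n" "n \<le> 3 * s + 3"
        and t: "t < L (xs ! q)" "3 * t < m" "m \<le> 3 * t + 3"
        using parent[of n p] parent[of m q] p q by auto
      let ?e = "piece (G (xs ! p)) s"
      have e: "?e = piece (G (xs ! q)) t"
      proof (rule edge_eq_if_labels_gt_half[of _ _ "\<phi> (p, n)"])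
        show "\<phi> (p, n) \<in> ?e" using mem s by simp
        show "\<phi> (p, n) \<in> piece (G (xs ! q)) t" using mem[of t m q] t eq by simp
        show "1 / 2 < B (\<phi> (p, n)) ?e" using br(3)[OF p(1) s] .
        show "1 / 2 < B (\<phi> (p, n)) (piece (G (xs ! q)) t)" using br(3)[OF q(1) t] eq by simp
      qed (use br(1) p(1) q(1) s(1) t(1) in blast)+
      have "\<phi> (p, 3 * s) \<in> piece (G (xs ! q)) t" using mem[of s "3 * s" p] e by simp
      then obtain d where d: "3 * t \<le> d" "d \<le> 3 * t + 3" "\<phi> (p, 3 * s) = \<phi> (q, d)"
        by (auto simp: \<phi>_def)
      have "\<not> 3 * t < d"
      proof
        assume "3 * t < d"
        then have "1 / 2 < B (\<phi> (p, 3 * s)) ?e" using br(3)[OF q(1) t(1) _ d(2)] d(3) e by simp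
        then show False using br(2)[OF p(1) s(1)] by simp
      qed
      then have "\<phi> (p, 3 * s) = \<phi> (q, 3 * t)" using d by simp
      then have "p = q \<and> 3 * s = 3 * t"
        using less.IH[of "3 * s" p q "3 * t"] p q s t by auto
      then have st: "p = q" "s = t" by auto
      \<comment> \<open>Four positions cover an edge of four vertices, so \<open>G (xs ! p)\<close>
        is injective on them.\<close>
      have "card ?e = 4" using H'(4)[OF br(1)[OF p(1) s(1)]] .
      then have "inj_on (G (xs ! p)) {3 * s..3 * s + 3}" by (intro eq_card_imp_inj_on) auto
      moreover have "G (xs ! p) n = G (xs ! p) m" using eq st by (simp add: \<phi>_def)
      ultimately have "n = m" using s t st by (auto dest: inj_onD)
      then show ?thesis using st by simp
    qed
  qed
  have "inj_on \<phi> (verts ?K)"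
  proof (rule inj_onI)
    fix v w assume "v \<in> verts ?K" "w \<in> verts ?K" "\<phi> v = \<phi> w"
    then show "v = w" using inj[of "fst v" "snd v" "fst w" "snd w"] by (auto simp: K)
  qed
  then have "bij_betw \<phi> (verts ?K) (verts H)" using img by (simp add: bij_betw_def)
  then have "hypergraph_iso H ?K" by (rule hypergraph_iso_if_bij_betw[OF _ E KE])
  then show ?thesis using cases by blast
qed

end

theorem theorem3:
  shows "(\<forall>r (H :: 'a hypergraph).
            5 \<le> r \<and> uniform_hypergraph r H \<and> spectral_radius r H \<le> rho_bound r
              \<longrightarrow> reducible H) \<and>
         (\<forall>H :: 'b hypergraph.
            uniform_hypergraph 4 H \<and> connected_hypergraph H \<and> \<not> reducible H \<longrightarrow>
              (spectral_radius 4 H \<le> rho_bound 4 \<longleftrightarrow>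
                 hypergraph_iso H (H4 1 1 2 2) \<or> hypergraph_iso H (H4 1 1 1 1) \<or>
                 hypergraph_iso H (H4 1 1 1 2) \<or> hypergraph_iso H (H4 1 1 1 3) \<or>
                 hypergraph_iso H (H4 1 1 1 4)))"
proof (intro conjI allI impI)
  fix r and H :: "'a hypergraph"
  assume "5 \<le> r \<and> uniform_hypergraph r H \<and> spectral_radius r H \<le> rho_bound r"
  then show "reducible H" using reducible_if_spectral_radius_le by blast
next
  fix H :: "'b hypergraph"
  assume asm: "uniform_hypergraph 4 H \<and> connected_hypergraph H \<and> \<not> reducible H"
  then have H: "uniform_hypergraph 4 H" and conn: "connected_hypergraph H" by auto
  obtain F where F: "F \<in> edges H" and nl: "\<And>v. v \<in> F \<Longrightarrow> \<not> leaf_vertex H v"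
    using asm by (auto simp: reducible_def)
  have "F \<noteq> {}" using uniform_hypergraphD(4)[OF H F] by auto
  then have ne: "verts H \<noteq> {}" using uniform_hypergraphD(3)[OF H F] by blast
  let ?iso = "\<lambda>i j k l. hypergraph_iso H (H4 i j k l)"
  let ?R = "?iso 1 1 2 2 \<or> ?iso 1 1 1 1 \<or> ?iso 1 1 1 2 \<or> ?iso 1 1 1 3 \<or> ?iso 1 1 1 4"
  show "spectral_radius 4 H \<le> rho_bound 4 \<longleftrightarrow> ?R"
  proof
    assume le: "spectral_radius 4 H \<le> rho_bound 4"
    have cr: "crossing H" by (rule crossing_if_connected[OF conn])
    obtain B where "normal_labelling H B"
      using normal_labelling_if_spectral_radius_le[OF H _ cr _ le] F by auto
    then interpret labelled_4_graph H B by (unfold_locales) (use H in auto)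
    show ?R using irreducible_iso_H4[OF cr F nl] by auto
  next
    have le: "spectral_radius 4 H \<le> rho_bound 4"
      if "?iso i j k l" "1 \<le> i" "1 \<le> j" "1 \<le> k" "1 \<le> l"
        "1 / 4 \<le> (1 - path_label i) * (1 - path_label j) * (1 - path_label k) * (1 - path_label l)"
      for i j k l
      using spectral_radius_H4_le[OF H ne] that by blast
    \<comment> \<open>Of the five products, the one for lengths 1, 1, 2, 2 is exactly 1/4, and the
      one for 1, 1, 1, 4 is 81/320.\<close>
    assume ?R
    then show "spectral_radius 4 H \<le> rho_bound 4"
      by (elim disjE) (rule le, assumption, simp_all add: path_label_def)+
  qed
qed

end
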